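(* Let $\omega>0$ and $c,d,a_0\in\mathbb{R}$ be fixed. For small $\epsilon>0$ let $u=u_\epsilon$ be the solution of $$\ddot u+\omega^2u+cu^2+\frac{d}{\epsilon}u^3=0$$ with initial data $u(0)=\epsilon a_0+o(\epsilon)$, $\dot u(0)=o(\epsilon)$ as $\epsilon\to0$. Then there exists $\gamma>0$ such that, for all $0\le t\le t_\epsilon=\frac{\gamma}{\epsilon}$, the solution satisfies the expansion $$u(t)=\epsilon a_0\cos(\nu_\epsilon t)+\epsilon^2r(\epsilon,t),\qquad \nu_\epsilon=\omega+3\epsilon\frac{d\,a_0^2}{8\omega},$$ where $r(\epsilon,\cdot)$ is uniformly bounded in $C^2(0,t_\epsilon)$.
   Context: A dot denotes $d/dt$, and $\epsilon$ is a small positive parameter. "$r(\epsilon,\cdot)$ is uniformly bounded in $C^2(0,t_\epsilon)$" means that there is a constant independent of $\epsilon$ (for $\epsilon>0$ small) bounding $|r|$, $|\partial_t r|$ and $|\partial_t^2 r|$ on $(0,t_\epsilon)$.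
   Formalization: Uniform boundedness of r in C^2 is claimed only if u(0)-εa_0 and u̇(0) are O(ε^2), which is necessary (u(0)=εa_0+ε^{3/2} gives r(ε,0)=ε^{-1/2}); for general o(ε) data the expansion holds with εr→0 in C^2 uniformly on (0,t_ε). *)

theory Defs
  imports "HOL-Analysis.Analysis" "HOL-Library.Landau_Symbols"
begin

text \<open>The solution is followed forward in time only, so \<^term>\<open>I\<close> is an interval starting at \<open>0\<close>
  and the derivatives are one-sided there; \<^term>\<open>v\<close> is the velocity, i.e. the time derivative
  of \<^term>\<open>u\<close>.\<close>

definition solves_on ::
  "real \<Rightarrow> real \<Rightarrow> real \<Rightarrow> real \<Rightarrow> real set \<Rightarrow> (real \<Rightarrow> real) \<Rightarrow> (real \<Rightarrow> real) \<Rightarrow> bool"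
where
  "solves_on \<omega> c d \<epsilon> I u v \<longleftrightarrow>
     (\<forall>t\<in>I. (u has_real_derivative v t) (at t within I) \<and>
            (\<exists>a. (v has_real_derivative a) (at t within I) \<and>
                 a + \<omega>\<^sup>2 * u t + c * (u t)\<^sup>2 + d / \<epsilon> * (u t) ^ 3 = 0))"

definition forward_interval :: "ereal \<Rightarrow> real set" where
  "forward_interval T = {t. 0 \<le> t \<and> ereal t < T}"

text \<open>Solution of the Cauchy problem in the usual sense: the maximal forward one, whose lifespan
  \<^term>\<open>T\<close> may be infinite. The initial data are \<^term>\<open>u 0\<close> and \<^term>\<open>v 0\<close>.\<close>

definition maximal_solution ::
  "real \<Rightarrow> real \<Rightarrow> real \<Rightarrow> real \<Rightarrow> ereal \<Rightarrow> (real \<Rightarrow> real) \<Rightarrow> (real \<Rightarrow> real) \<Rightarrow> bool"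
where
  "maximal_solution \<omega> c d \<epsilon> T u v \<longleftrightarrow>
     0 < T \<and> solves_on \<omega> c d \<epsilon> (forward_interval T) u v \<and>
     \<not> (\<exists>T' u' v'. T < T' \<and> solves_on \<omega> c d \<epsilon> (forward_interval T') u' v' \<and>
           (\<forall>t\<in>forward_interval T. u' t = u t \<and> v' t = v t))"

text \<open>For open \<^term>\<open>I\<close>: \<^term>\<open>f\<close> is of class \<open>C\<^sup>2\<close> on \<^term>\<open>I\<close>, and \<^term>\<open>f\<close>, its first and
  its second derivative are bounded by \<^term>\<open>M\<close> there.\<close>

definition C2_bounded_by :: "real set \<Rightarrow> real \<Rightarrow> (real \<Rightarrow> real) \<Rightarrow> bool" where
  "C2_bounded_by I M f \<longleftrightarrow>
     (\<exists>f' f''. continuous_on I f'' \<and>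
        (\<forall>t\<in>I. (f has_real_derivative f' t) (at t) \<and> (f' has_real_derivative f'' t) (at t) \<and>
                \<bar>f t\<bar> \<le> M \<and> \<bar>f' t\<bar> \<le> M \<and> \<bar>f'' t\<bar> \<le> M))"

definition \<nu> :: "real \<Rightarrow> real \<Rightarrow> real \<Rightarrow> real \<Rightarrow> real" where
  "\<nu> \<omega> d a\<^sub>0 \<epsilon> = \<omega> + 3 * \<epsilon> * (d * a\<^sub>0\<^sup>2 / (8 * \<omega>))"

end

theory Submission
  imports Defs
begin

text \<open>
  Put \<open>u = \<epsilon> w\<close>, so that \<open>w'' + \<omega>\<^sup>2 w + \<epsilon> (c w\<^sup>2 + d w\<^sup>3) = 0\<close>. With \<open>\<phi> = \<nu> t\<close>, the
  function \<open>a cos \<phi> + \<epsilon> (p + q cos 2\<phi> + s cos 3\<phi>)\<close> solves this equation up to \<open>O(\<epsilon>\<^sup>2)\<close>: the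
  correction to the frequency removes the resonant term \<open>cos \<phi>\<close>, and \<open>p\<close>, \<open>q\<close>, \<open>s\<close> remove the
  nonresonant ones. The energy \<open>N = e'\<^sup>2 + \<omega>\<^sup>2 e\<^sup>2\<close> of the difference \<open>e\<close> satisfies
  \<open>N' \<le> \<epsilon> L (N + C\<^sup>2 \<epsilon>\<^sup>2)\<close> as long as \<open>\<bar>e\<bar> < 1\<close>, so on times up to \<open>1 / \<epsilon>\<close> it stays comparable to
  \<open>N(0) + \<epsilon>\<^sup>2\<close>, and a bootstrap shows that \<open>\<bar>e\<bar> < 1\<close> persists. In particular the solution stays
  bounded, and a bounded solution can be continued: local solutions are given by power series, since
  the equation is polynomial.
\<close>

section \<open>Local solutions of a cubic oscillator by power series\<close>

text \<open>Taylor coefficients at \<open>0\<close> of the solution of \<open>U'' = - (\<alpha> U + \<beta> U\<^sup>2 + \<delta> U\<^sup>3)\<close> with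
  \<open>U(0) = x\<close>, \<open>U'(0) = v\<close>.\<close>

function cubic_coeff :: "real \<Rightarrow> real \<Rightarrow> real \<Rightarrow> real \<Rightarrow> real \<Rightarrow> nat \<Rightarrow> real" where
  "cubic_coeff \<alpha> \<beta> \<delta> x v 0 = x"
| "cubic_coeff \<alpha> \<beta> \<delta> x v (Suc 0) = v"
| "cubic_coeff \<alpha> \<beta> \<delta> x v (Suc (Suc n)) =
     - (\<alpha> * cubic_coeff \<alpha> \<beta> \<delta> x v n
        + \<beta> * (\<Sum>i=0..n. cubic_coeff \<alpha> \<beta> \<delta> x v i * cubic_coeff \<alpha> \<beta> \<delta> x v (n - i))
        + \<delta> * (\<Sum>i=0..n. (\<Sum>j=0..i. cubic_coeff \<alpha> \<beta> \<delta> x v j * cubic_coeff \<alpha> \<beta> \<delta> x v (i - j))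
                 * cubic_coeff \<alpha> \<beta> \<delta> x v (n - i)))
     / (real (Suc n) * real (Suc (Suc n)))"
  by pat_completeness auto
termination
  by (relation "Wellfounded.measure (\<lambda>(\<alpha>, \<beta>, \<delta>, x, v, n). n)") auto

text \<open>A geometric majorant propagates through the recursion. The double and triple
  convolutions consist of at most \<open>k + 1\<close> and \<open>(k + 1)^2\<close> terms, each
  bounded by \<open>M^2 * R^k\<close> or \<open>M^3 * R^k\<close>; the divisor
  \<open>(k + 1) * (k + 2)\<close> produced by two integrations absorbs these counts, and the last
  hypothesis then closes the induction.\<close>

lemma abs_cubic_coeff_le:
  assumes M: "0 \<le> M" and R: "0 \<le> R" and x: "\<bar>x\<bar> \<le> M" and v: "\<bar>v\<bar> \<le> M * R"
    and MR: "\<bar>\<alpha>\<bar> * M + \<bar>\<beta>\<bar> * M\<^sup>2 + \<bar>\<delta>\<bar> * M ^ 3 \<le> M * R\<^sup>2"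
  shows "\<bar>cubic_coeff \<alpha> \<beta> \<delta> x v n\<bar> \<le> M * R ^ n"
proof (induction n rule: less_induct)
  case (less n)
  show ?case
  proof (cases n)
    case 0
    then show ?thesis using x by simp
  next
    case (Suc m)
    show ?thesis
    proof (cases m)
      case 0
      then show ?thesis using v Suc by simp
    next
      case (Suc k)
      let ?a = "cubic_coeff \<alpha> \<beta> \<delta> x v"
      have n: "n = Suc (Suc k)" using \<open>n = Suc m\<close> Suc by simp
      have IH: "\<bar>?a i\<bar> \<le> M * R ^ i" if "i \<le> k" for i
        using less.IH[of i] that n by simp
      have conv: "\<bar>\<Sum>j=0..i. ?a j * ?a (i - j)\<bar> \<le> real (Suc i) * (M\<^sup>2 * R ^ i)" if "i \<le> k" for i
      proof -
        have "\<bar>?a j * ?a (i - j)\<bar> \<le> M\<^sup>2 * R ^ i" if "j \<in> {0..i}" for j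
        proof -
          have "\<bar>?a j\<bar> * \<bar>?a (i - j)\<bar> \<le> (M * R ^ j) * (M * R ^ (i - j))"
            using IH[of j] IH[of "i - j"] that \<open>i \<le> k\<close> M R by (intro mult_mono) auto
          also have "\<dots> = M\<^sup>2 * (R ^ j * R ^ (i - j))"
            by (simp add: power2_eq_square)
          also have "\<dots> = M\<^sup>2 * R ^ i"
            using that by (simp flip: power_add)
          finally show ?thesis by (simp add: abs_mult)
        qed
        then have "(\<Sum>j=0..i. \<bar>?a j * ?a (i - j)\<bar>) \<le> (\<Sum>j=0..i. M\<^sup>2 * R ^ i)"
          by (intro sum_mono) auto
        then show ?thesis
          by (intro order_trans[OF sum_abs]) simp
      qed
      let ?P = "real (Suc k) * real (Suc (Suc k))"
      let ?S2 = "\<Sum>i=0..k. ?a i * ?a (k - i)"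
      let ?S3 = "\<Sum>i=0..k. (\<Sum>j=0..i. ?a j * ?a (i - j)) * ?a (k - i)"
      have "\<bar>(\<Sum>j=0..i. ?a j * ?a (i - j)) * ?a (k - i)\<bar> \<le> real (Suc k) * (M ^ 3 * R ^ k)"
        if "i \<in> {0..k}" for i
      proof -
        have "\<bar>\<Sum>j=0..i. ?a j * ?a (i - j)\<bar> * \<bar>?a (k - i)\<bar>
            \<le> (real (Suc i) * (M\<^sup>2 * R ^ i)) * (M * R ^ (k - i))"
          using conv[of i] IH[of "k - i"] that M R by (intro mult_mono) auto
        also have "\<dots> = real (Suc i) * (M ^ 3 * (R ^ i * R ^ (k - i)))"
          by (simp add: power2_eq_square power3_eq_cube)
        also have "\<dots> = real (Suc i) * (M ^ 3 * R ^ k)"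
          using that by (simp flip: power_add)
        also have "\<dots> \<le> real (Suc k) * (M ^ 3 * R ^ k)"
          using that M R by (intro mult_right_mono) auto
        finally show ?thesis by (simp add: abs_mult)
      qed
      then have "(\<Sum>i=0..k. \<bar>(\<Sum>j=0..i. ?a j * ?a (i - j)) * ?a (k - i)\<bar>)
          \<le> (\<Sum>i=0..k. real (Suc k) * (M ^ 3 * R ^ k))"
        by (intro sum_mono) auto
      then have "\<bar>?S3\<bar> \<le> real (Suc k) * (real (Suc k) * (M ^ 3 * R ^ k))"
        by (intro order_trans[OF sum_abs]) simp
      also have "\<dots> \<le> real (Suc k) * (real (Suc (Suc k)) * (M ^ 3 * R ^ k))"
        using M R by (intro mult_left_mono mult_right_mono) auto
      finally have S3: "\<bar>?S3\<bar> \<le> ?P * (M ^ 3 * R ^ k)" by (simp only: mult.assoc)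
      have S2: "\<bar>?S2\<bar> \<le> ?P * (M\<^sup>2 * R ^ k)"
      proof -
        have "real (Suc k) * (M\<^sup>2 * R ^ k) \<le> ?P * (M\<^sup>2 * R ^ k)"
          using M R by (intro mult_right_mono) auto
        then show ?thesis using conv[of k] by linarith
      qed
      have S1: "\<bar>?a k\<bar> \<le> ?P * (M * R ^ k)"
      proof -
        have "1 * (M * R ^ k) \<le> ?P * (M * R ^ k)"
          using M R by (intro mult_right_mono) (auto simp: field_simps)
        then show ?thesis using IH[of k] by linarith
      qed
      have "\<bar>\<alpha> * ?a k + \<beta> * ?S2 + \<delta> * ?S3\<bar> \<le> \<bar>\<alpha>\<bar> * \<bar>?a k\<bar> + \<bar>\<beta>\<bar> * \<bar>?S2\<bar> + \<bar>\<delta>\<bar> * \<bar>?S3\<bar>"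
        unfolding abs_mult[symmetric] by linarith
      also have "\<dots> \<le> \<bar>\<alpha>\<bar> * (?P * (M * R ^ k)) + \<bar>\<beta>\<bar> * (?P * (M\<^sup>2 * R ^ k)) + \<bar>\<delta>\<bar> * (?P * (M ^ 3 * R ^ k))"
        by (intro add_mono mult_left_mono S1 S2 S3) auto
      also have "\<dots> = (?P * R ^ k) * (\<bar>\<alpha>\<bar> * M + \<bar>\<beta>\<bar> * M\<^sup>2 + \<bar>\<delta>\<bar> * M ^ 3)"
        by (simp only: algebra_simps)
      also have "\<dots> \<le> (?P * R ^ k) * (M * R\<^sup>2)"
        using MR R by (intro mult_left_mono) auto
      also have "\<dots> = (M * R ^ n) * ?P"
        unfolding n by (simp only: power_Suc power2_eq_square ac_simps)
      finally have "\<bar>\<alpha> * ?a k + \<beta> * ?S2 + \<delta> * ?S3\<bar> / ?P \<le> M * R ^ n"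
        by (subst pos_divide_le_eq) auto
      then show ?thesis
        unfolding n cubic_coeff.simps(3) by (simp only: abs_divide abs_minus_cancel abs_mult abs_of_nat)
    qed
  qed
qed

text \<open>The recursion makes the equation an identity of formal power series. The geometric bound
  on the coefficients gives a radius of convergence of at least \<open>1 / R\<close>, and inside it
  evaluation commutes with derivatives, sums and products.\<close>

lemma cubic_oscillator_local_solution:
  fixes \<alpha> \<beta> \<delta> x v :: real
  obtains h U V where "h > 0" and "U 0 = x" and "V 0 = v"
    and "\<And>t. \<bar>t\<bar> < h \<Longrightarrow> (U has_real_derivative V t) (at t)"
    and "\<And>t. \<bar>t\<bar> < h \<Longrightarrow>
      (V has_real_derivative - (\<alpha> * U t + \<beta> * (U t)\<^sup>2 + \<delta> * (U t) ^ 3)) (at t)"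
proof -
  define M where "M = \<bar>x\<bar> + 1"
  define B where "B = \<bar>\<alpha>\<bar> + \<bar>\<beta>\<bar> * M + \<bar>\<delta>\<bar> * M\<^sup>2"
  \<comment> \<open>\<open>R\<close> dominates \<open>\<bar>v\<bar>\<close>, \<open>B\<close> and 1.
    As \<open>M \<ge> 1\<close>, this yields \<open>\<bar>v\<bar> \<le> M * R\<close>, and
    \<open>B \<le> R \<le> R * R\<close> yields the bound required of the cubic.\<close>
  define R where "R = \<bar>v\<bar> + B + 1"
  have M: "M \<ge> 1" by (simp add: M_def)
  have B: "B \<ge> 0" using M by (simp add: B_def)
  have R: "R \<ge> 1" using B by (simp add: R_def)
  have "\<bar>v\<bar> \<le> 1 * R" using B by (simp add: R_def)
  also have "\<dots> \<le> M * R" using M R by (intro mult_right_mono) auto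
  finally have v: "\<bar>v\<bar> \<le> M * R" .
  have "B \<le> R * 1" using B by (simp add: R_def)
  also have "\<dots> \<le> R\<^sup>2" using R unfolding power2_eq_square by (intro mult_left_mono) auto
  finally have "M * B \<le> M * R\<^sup>2" using M by simp
  then have MR: "\<bar>\<alpha>\<bar> * M + \<bar>\<beta>\<bar> * M\<^sup>2 + \<bar>\<delta>\<bar> * M ^ 3 \<le> M * R\<^sup>2"
    by (simp add: B_def power2_eq_square power3_eq_cube algebra_simps)
  define F where "F = Abs_fps (cubic_coeff \<alpha> \<beta> \<delta> x v)"
  have F_le: "\<bar>fps_nth F n\<bar> \<le> M * R ^ n" for n
    unfolding F_def fps_nth_Abs_fps
    using M R v MR by (intro abs_cubic_coeff_le) (auto simp: M_def)
  have rad: "fps_conv_radius F \<ge> 1 / R"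
    unfolding fps_conv_radius_def
  proof (rule conv_radius_geI_ex')
    fix r assume r: "0 < r" "ereal r < ereal (1 / R)"
    have "summable (\<lambda>n. M * (R * r) ^ n)"
      using r R by (intro summable_mult summable_geometric) (auto simp: field_simps)
    then show "summable (\<lambda>n. fps_nth F n * of_real r ^ n)"
    proof (rule summable_comparison_test'[where N = 0])
      fix n
      have "\<bar>fps_nth F n\<bar> * r ^ n \<le> (M * R ^ n) * r ^ n"
        using F_le r by (intro mult_right_mono) auto
      then show "norm (fps_nth F n * of_real r ^ n) \<le> M * (R * r) ^ n"
        using r by (simp add: abs_mult power_mult_distrib)
    qed
  qed
  let ?H = "fps_const (- \<alpha>) * F + fps_const (- \<beta>) * (F * F) + fps_const (- \<delta>) * (F * F * F)"
  \<comment> \<open>Two formal derivatives multiply coefficient \<open>n + 2\<close> by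
    \<open>(n + 1) * (n + 2)\<close>, which cancels the divisor of the recursion; the sums that
    remain are the Cauchy products.\<close>
  have ode: "fps_deriv (fps_deriv F) = ?H"
  proof (rule fps_ext)
    fix n
    have "fps_nth (fps_deriv (fps_deriv F)) n
        = real (Suc n) * real (Suc (Suc n)) * cubic_coeff \<alpha> \<beta> \<delta> x v (Suc (Suc n))"
      by (simp add: F_def algebra_simps)
    also have "\<dots> = - (\<alpha> * fps_nth F n + \<beta> * fps_nth (F * F) n + \<delta> * fps_nth (F * F * F) n)"
      unfolding cubic_coeff.simps(3) F_def fps_mult_nth fps_nth_Abs_fps
      by (simp only: times_divide_eq_right) (simp del: of_nat_Suc cubic_coeff.simps)
    finally show "fps_nth (fps_deriv (fps_deriv F)) n = fps_nth ?H n"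
      by simp
  qed
  show ?thesis
  proof (rule that[of "1 / R" "eval_fps F" "eval_fps (fps_deriv F)"])
    show "1 / R > 0" using R by simp
    show "eval_fps F 0 = x" "eval_fps (fps_deriv F) 0 = v"
      by (simp_all add: eval_fps_at_0 F_def)
    fix t :: real assume t: "\<bar>t\<bar> < 1 / R"
    have t0: "ereal (norm t) < fps_conv_radius F"
      using t rad by (metis ereal_less_eq(3) less_ereal.simps(1) order_less_le_trans real_norm_def)
    then have t1: "ereal (norm t) < fps_conv_radius (fps_deriv F)"
      using fps_conv_radius_deriv[of F] by order
    have t2: "ereal (norm t) < fps_conv_radius (F * F)"
      using fps_conv_radius_mult[of F F] t0 by simp
    have t3: "ereal (norm t) < fps_conv_radius (F * F * F)"
      using fps_conv_radius_mult[of "F * F" F] t0 t2 by (meson min_less_iff_conj order_less_le_trans)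
    have cm: "ereal (norm t) < fps_conv_radius (fps_const c * G)" if "ereal (norm t) < fps_conv_radius G" for c G
      using fps_conv_radius_mult[of "fps_const c" G] that by auto
    show "(eval_fps F has_real_derivative eval_fps (fps_deriv F) t) (at t)"
      by (rule has_field_derivative_eval_fps[OF t0])
    have "eval_fps (fps_deriv (fps_deriv F)) t
        = - (\<alpha> * eval_fps F t + \<beta> * (eval_fps F t)\<^sup>2 + \<delta> * (eval_fps F t) ^ 3)"
    proof -
      have t12: "ereal (norm t) < fps_conv_radius (fps_const (- \<alpha>) * F + fps_const (- \<beta>) * (F * F))"
        using fps_conv_radius_add[of "fps_const (- \<alpha>) * F" "fps_const (- \<beta>) * (F * F)"] cm[OF t0] cm[OF t2]
        by (meson min_less_iff_conj order_less_le_trans)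
      show ?thesis
        unfolding ode using t0 t2 t3 t12 cm[OF t0] cm[OF t2] cm[OF t3]
        by (simp add: eval_fps_add eval_fps_mult power2_eq_square power3_eq_cube)
    qed
    then show "(eval_fps (fps_deriv F) has_real_derivative
        - (\<alpha> * eval_fps F t + \<beta> * (eval_fps F t)\<^sup>2 + \<delta> * (eval_fps F t) ^ 3)) (at t)"
      using has_field_derivative_eval_fps[OF t1, of UNIV] by simp
  qed
qed

section \<open>Continuation of bounded solutions\<close>

text \<open>A bounded derivative makes \<open>f\<close> Lipschitz, hence uniformly continuous, so
  \<open>f\<close> extends continuously to the closed interval. This supplies the end values from
  which a solution is restarted.\<close>

lemma bounded_derivative_tendsto_at_left:
  fixes f f' :: "real \<Rightarrow> real"
  assumes "a < b"
    and der: "\<And>t. t \<in> {a..<b} \<Longrightarrow> (f has_real_derivative f' t) (at t within {a..<b})"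
    and bound: "\<And>t. t \<in> {a..<b} \<Longrightarrow> \<bar>f' t\<bar> \<le> B"
  obtains l where "(f \<longlongrightarrow> l) (at_left b)"
proof -
  have "B \<ge> 0" using bound[of a] \<open>a < b\<close> by auto
  have "norm (f x - f y) \<le> B * norm (x - y)" if "x \<in> {a..<b}" "y \<in> {a..<b}" for x y
    by (rule field_differentiable_bound[OF _ der]) (use bound that in auto)
  then have "B-lipschitz_on {a..<b} f"
    using \<open>B \<ge> 0\<close> by (intro lipschitz_onI) (auto simp: dist_norm)
  then obtain g where g: "uniformly_continuous_on (closure {a..<b}) g" "\<And>x. x \<in> {a..<b} \<Longrightarrow> f x = g x"
    using uniformly_continuous_on_extension_on_closure[OF lipschitz_on_uniformly_continuous] by metis
  have "continuous_on {a..b} g"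
    using g(1) \<open>a < b\<close> by (simp add: uniformly_continuous_imp_continuous)
  then have "(g \<longlongrightarrow> g b) (at b within {a..b})"
    using \<open>a < b\<close> by (simp add: continuous_on)
  then have "(g \<longlongrightarrow> g b) (at_left b)"
    using \<open>a < b\<close> by (simp add: at_within_Icc_at_left)
  moreover have "\<forall>\<^sub>F x in at_left b. g x = f x"
    using eventually_at_left_real[OF \<open>a < b\<close>] by eventually_elim (use g(2) in auto)
  ultimately have "(f \<longlongrightarrow> g b) (at_left b)"
    using filterlim_cong by blast
  then show ?thesis by (rule that)
qed

text \<open>The difference quotient of the glued function is treated on each side separately: on the
  left l'Hopital's rule reduces it to the limit of \<open>f'\<close>, on the right it is the
  quotient of \<open>g\<close>.\<close>

lemma has_real_derivative_glue:
  fixes f g :: "real \<Rightarrow> real"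
  assumes "a < b"
    and der: "\<And>t. a < t \<Longrightarrow> t < b \<Longrightarrow> (f has_real_derivative f' t) (at t)"
    and lim: "(f \<longlongrightarrow> g b) (at_left b)" and lim': "(f' \<longlongrightarrow> l) (at_left b)"
    and g: "(g has_real_derivative l) (at b)"
  shows "((\<lambda>t. if t < b then f t else g t) has_real_derivative l) (at b)"
proof -
  define q where "q = (\<lambda>t. ((if t < b then f t else g t) - g b) / (t - b))"
  have ev: "\<forall>\<^sub>F t in at_left b. t \<in> {a<..<b}"
    by (rule eventually_at_left_real[OF \<open>a < b\<close>])
  have "((\<lambda>t. (f t - g b) / (t - b)) \<longlongrightarrow> l) (at_left b)"
  proof (rule lhopital_left[where f' = f' and g' = "\<lambda>_. 1"])
    show "((\<lambda>t. f t - g b) \<longlongrightarrow> 0) (at_left b)"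
      using tendsto_diff[OF lim tendsto_const[of "g b"]] by simp
    show "((\<lambda>t. t - b) \<longlongrightarrow> 0) (at_left b)"
      by (auto intro!: tendsto_eq_intros)
    show "\<forall>\<^sub>F t in at_left b. t - b \<noteq> 0"
      using ev by eventually_elim auto
    show "\<forall>\<^sub>F t in at_left b. ((\<lambda>t. f t - g b) has_real_derivative f' t) (at t)"
      using ev by eventually_elim (auto intro!: derivative_eq_intros der)
    show "\<forall>\<^sub>F t in at_left b. ((\<lambda>t. t - b) has_real_derivative 1) (at t)"
      by (intro always_eventually allI) (auto intro!: derivative_eq_intros)
  qed (use lim' in auto)
  then have "(q \<longlongrightarrow> l) (at_left b)"
    by (rule Lim_transform_eventually)
       (use ev in \<open>eventually_elim, auto simp: q_def\<close>)
  moreover have "(q \<longlongrightarrow> l) (at_right b)"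
  proof (rule Lim_transform_eventually)
    show "((\<lambda>t. (g t - g b) / (t - b)) \<longlongrightarrow> l) (at_right b)"
      using g has_field_derivative_at_within has_field_derivative_iff by blast
    show "\<forall>\<^sub>F t in at_right b. (g t - g b) / (t - b) = q t"
      by (auto simp: eventually_at_filter q_def)
  qed
  ultimately have "(q \<longlongrightarrow> l) (at b)"
    by (simp add: filterlim_at_split)
  then show ?thesis
    by (simp add: has_field_derivative_iff q_def)
qed

lemma forward_interval_ereal: "forward_interval (ereal s) = {0..<s}"
  by (auto simp: forward_interval_def)

lemma solves_on_iff:
  "solves_on \<omega> c d \<epsilon> I u v \<longleftrightarrow>
     (\<forall>t\<in>I. (u has_real_derivative v t) (at t within I) \<and>
       (v has_real_derivative - (\<omega>\<^sup>2 * u t + c * (u t)\<^sup>2 + d / \<epsilon> * (u t) ^ 3)) (at t within I))"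
proof -
  have "a + p + q + r = 0 \<longleftrightarrow> a = - (p + q + r)" for a p q r :: real
    by linarith
  then show ?thesis
    unfolding solves_on_def by (auto simp del: minus_add_distrib)
qed

text \<open>If position and velocity stay bounded up to a finite lifespan \<open>s\<close>, both
  have limits there. A local solution started from these limits, glued on at \<open>s\<close>, is a
  strictly longer solution, against maximality.\<close>

lemma maximal_solution_unbounded:
  assumes max: "maximal_solution \<omega> c d \<epsilon> T u v" and "T < \<infinity>"
    and u: "\<And>t. t \<in> forward_interval T \<Longrightarrow> \<bar>u t\<bar> \<le> B"
    and v: "\<And>t. t \<in> forward_interval T \<Longrightarrow> \<bar>v t\<bar> \<le> B"
  shows False
proof -
  define a where "a = (\<lambda>x. - (\<omega>\<^sup>2 * x + c * x\<^sup>2 + d / \<epsilon> * x ^ 3))"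
  have "0 < T" using max by (simp add: maximal_solution_def)
  then obtain s where s: "T = ereal s" "s > 0"
    using \<open>T < \<infinity>\<close> by (cases T) auto
  define I where "I = {0..<s}"
  have I: "forward_interval T = I" by (simp add: s I_def forward_interval_ereal)
  have sol: "(u has_real_derivative v t) (at t within I)" "(v has_real_derivative a (u t)) (at t within I)"
    if "t \<in> I" for t
    using max that by (auto simp: maximal_solution_def solves_on_iff I a_def)
  have sol_at: "(u has_real_derivative v t) (at t)" "(v has_real_derivative a (u t)) (at t)"
    if "0 < t" "t < s" for t
  proof -
    have "at t within I = at t"
      unfolding I_def using that by (intro at_within_interior) auto
    then show "(u has_real_derivative v t) (at t)" "(v has_real_derivative a (u t)) (at t)"
      using sol[of t] that by (simp_all add: I_def)
  qed
  have cont_a: "continuous_on UNIV a"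
    unfolding a_def by (intro continuous_intros)
  \<comment> \<open>A bound on the position bounds the acceleration \<open>a (u t)\<close> by
    compactness, so the velocity has a left limit as well.\<close>
  have "compact (a ` cball 0 B)"
    by (intro compact_continuous_image continuous_on_subset[OF cont_a]) auto
  then obtain B' where "\<forall>y\<in>a ` cball 0 B. norm y \<le> B'"
    using compact_imp_bounded bounded_iff by blast
  then have B': "\<bar>a (u t)\<bar> \<le> B'" if "t \<in> I" for t
    using u that by (simp add: I)
  obtain x where x: "(u \<longlongrightarrow> x) (at_left s)"
    using bounded_derivative_tendsto_at_left[of 0 s u v B] s sol(1) v unfolding I I_def by blast
  obtain y where y: "(v \<longlongrightarrow> y) (at_left s)"
    using bounded_derivative_tendsto_at_left[of 0 s v "\<lambda>t. a (u t)" B'] s sol(2) B' unfolding I_def by blast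
  have ax: "((\<lambda>t. a (u t)) \<longlongrightarrow> a x) (at_left s)"
    using cont_a x by (intro isCont_tendsto_compose[of _ a]) (simp add: continuous_on_eq_continuous_at)
  obtain h U V where h: "h > 0" and UV0: "U 0 = x" "V 0 = y"
    and U: "\<And>t. \<bar>t\<bar> < h \<Longrightarrow> (U has_real_derivative V t) (at t)"
    and V: "\<And>t. \<bar>t\<bar> < h \<Longrightarrow> (V has_real_derivative a (U t)) (at t)"
    unfolding a_def by (rule cubic_oscillator_local_solution[of x y "\<omega>\<^sup>2" c "d / \<epsilon>"]) blast
  have U': "((\<lambda>t. U (t - s)) has_real_derivative V (t - s)) (at t)"
    and V': "((\<lambda>t. V (t - s)) has_real_derivative a (U (t - s))) (at t)" if "\<bar>t - s\<bar> < h" for t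
    using U[OF that] V[OF that] by (simp_all add: DERIV_shift[of _ _ t "- s", simplified])
  \<comment> \<open>From \<open>s\<close> on, the local solution takes over, translated so that its
    time origin falls on \<open>s\<close>.\<close>
  define u' where "u' = (\<lambda>t. if t < s then u t else U (t - s))"
  define v' where "v' = (\<lambda>t. if t < s then v t else V (t - s))"
  define I' where "I' = {0..<s + h}"
  have "(u' has_real_derivative v' t) (at t within I') \<and> (v' has_real_derivative a (u' t)) (at t within I')"
    if t: "t \<in> I'" for t
  proof (cases t s rule: linorder_cases)
    case less
    have tI: "t \<in> I" using t less by (simp add: I_def I'_def)
    \<comment> \<open>Near a time before \<open>s\<close> the two intervals coincide; this also
      covers \<open>t = 0\<close>, where the derivative is one-sided.\<close>
    have "at t within I' = at t within I"
      by (rule at_within_nhd[of _ "{..<s}"]) (use less h in \<open>auto simp: I_def I'_def\<close>)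
    moreover have "(u' has_real_derivative v t) (at t within I)"
      by (rule has_field_derivative_transform_within[OF sol(1)[OF tI] zero_less_one tI])
         (auto simp: u'_def I_def)
    moreover have "(v' has_real_derivative a (u t)) (at t within I)"
      by (rule has_field_derivative_transform_within[OF sol(2)[OF tI] zero_less_one tI])
         (auto simp: v'_def I_def)
    ultimately show ?thesis using less by (simp add: u'_def v'_def)
  next
    case equal
    have "(u' has_real_derivative y) (at s)"
      unfolding u'_def
    proof (rule has_real_derivative_glue[OF \<open>s > 0\<close> sol_at(1)])
      show "((\<lambda>t. U (t - s)) has_real_derivative y) (at s)" using U'[of s] h UV0 by simp
    qed (use x y UV0 in simp_all)
    moreover have "(v' has_real_derivative a x) (at s)"
      unfolding v'_def
    proof (rule has_real_derivative_glue[OF \<open>s > 0\<close> sol_at(2)])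
      show "((\<lambda>t. V (t - s)) has_real_derivative a x) (at s)" using V'[of s] h UV0 by simp
    qed (use y ax UV0 in simp_all)
    ultimately show ?thesis
      using equal UV0 by (simp add: u'_def v'_def has_field_derivative_at_within)
  next
    case greater
    then have th: "\<bar>t - s\<bar> < h" using t by (simp add: I'_def)
    have "(u' has_real_derivative V (t - s)) (at t)"
      by (rule has_field_derivative_transform_within_open[OF U'[OF th], of "{s<..}"])
         (use greater in \<open>auto simp: u'_def\<close>)
    moreover have "(v' has_real_derivative a (U (t - s))) (at t)"
      by (rule has_field_derivative_transform_within_open[OF V'[OF th], of "{s<..}"])
         (use greater in \<open>auto simp: v'_def\<close>)
    ultimately show ?thesis
      using greater by (simp add: u'_def v'_def has_field_derivative_at_within)
  qed
  then have "solves_on \<omega> c d \<epsilon> (forward_interval (ereal (s + h))) u' v'"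
    by (simp add: solves_on_iff forward_interval_ereal I'_def a_def)
  moreover have "\<forall>t\<in>forward_interval T. u' t = u t \<and> v' t = v t"
    by (auto simp: I I_def u'_def v'_def)
  moreover have "T < ereal (s + h)" using s h by simp
  ultimately show False
    using max unfolding maximal_solution_def by blast
qed

section \<open>Bootstrap and energy estimate\<close>

text \<open>Were the bound to fail, the compact set of times with \<open>B \<le> f\<close> would
  have a first element, and there the step applies. The initial condition is contained in the step:
  at \<open>t = a\<close> its premise is vacuous.\<close>

lemma continuous_on_bootstrap:
  fixes f :: "real \<Rightarrow> real"
  assumes cont: "continuous_on {a..b} f"
    and step: "\<And>t. t \<in> {a..b} \<Longrightarrow> (\<And>s. s \<in> {a..<t} \<Longrightarrow> f s < B) \<Longrightarrow> f t < B"
    and t: "t \<in> {a..b}"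
  shows "f t < B"
proof (rule ccontr)
  assume "\<not> f t < B"
  define S where "S = {s \<in> {a..b}. B \<le> f s}"
  have "compact S"
  proof -
    have "closed S"
      using continuous_closed_preimage[OF cont, of "{B..}"] by (simp add: S_def vimage_def Int_def)
    moreover have "bounded S"
      by (rule bounded_subset[OF bounded_closed_interval[of a b]]) (auto simp: S_def)
    ultimately show ?thesis by (simp add: compact_eq_bounded_closed)
  qed
  moreover have "t \<in> S" using t \<open>\<not> f t < B\<close> by (simp add: S_def)
  ultimately obtain t0 where t0: "t0 \<in> S" "\<And>s. s \<in> S \<Longrightarrow> t0 \<le> s"
    using compact_attains_inf by (metis empty_iff)
  have "f t0 < B"
  proof (rule step)
    fix s assume s: "s \<in> {a..<t0}"
    show "f s < B"
    proof (rule ccontr)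
      assume "\<not> f s < B"
      then have "s \<in> S" using s t0(1) by (auto simp: S_def)
      then show False using s t0(2)[of s] by auto
    qed
  qed (use t0(1) in \<open>simp add: S_def\<close>)
  then show False using t0(1) by (simp add: S_def)
qed

text \<open>A Gronwall argument. Adding the constant \<open>C\<^sup>2 * \<epsilon>\<^sup>2\<close>
  to the energy turns the inequality with a source into the homogeneous
  \<open>N' \<le> \<epsilon> * L * N\<close>, whose growth factor is at most \<open>exp L\<close>
  because \<open>\<epsilon> * \<tau> \<le> 1\<close>. The condition
  \<open>m < \<omega>\<^sup>2\<close> is what turns the energy bound back into
  \<open>\<bar>e\<bar> < 1\<close>.\<close>

lemma perturbed_oscillator_energy_le:
  fixes e e' G R :: "real \<Rightarrow> real"
  assumes "\<omega> > 0" "\<epsilon> > 0" "K \<ge> 0" "\<epsilon> * \<tau> \<le> 1"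
    and cont: "continuous_on {0..\<tau>} e" "continuous_on {0..\<tau>} e'"
    and der: "\<And>t. 0 < t \<Longrightarrow> t < \<tau> \<Longrightarrow> (e has_real_derivative e' t) (at t)"
      "\<And>t. 0 < t \<Longrightarrow> t < \<tau> \<Longrightarrow>
         (e' has_real_derivative - (\<omega>\<^sup>2 * e t) - \<epsilon> * G t * e t - R t) (at t)"
    and G: "\<And>t. 0 < t \<Longrightarrow> t < \<tau> \<Longrightarrow> \<bar>e t\<bar> < 1 \<Longrightarrow> \<bar>G t\<bar> \<le> K"
    and R: "\<And>t. 0 < t \<Longrightarrow> t < \<tau> \<Longrightarrow> \<bar>R t\<bar> \<le> C * \<epsilon>\<^sup>2"
    and m: "((e' 0)\<^sup>2 + \<omega>\<^sup>2 * (e 0)\<^sup>2 + C\<^sup>2 * \<epsilon>\<^sup>2) * exp (K + K / \<omega>\<^sup>2 + 1) \<le> m" "m < \<omega>\<^sup>2"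
    and t: "t \<in> {0..\<tau>}"
  shows "(e' t)\<^sup>2 + \<omega>\<^sup>2 * (e t)\<^sup>2 \<le> m"
proof -
  \<comment> \<open>Chosen so that \<open>L\<close> dominates the coefficient \<open>K + 1\<close>
    of \<open>e'^2\<close> and the coefficient 1 of \<open>C\<^sup>2 * \<epsilon>\<^sup>2\<close>,
    while \<open>L * \<omega>\<^sup>2\<close> dominates the coefficient \<open>K\<close> of
    \<open>e^2\<close>.\<close>
  define L where "L = K + K / \<omega>\<^sup>2 + 1"
  define N where "N = (\<lambda>t. (e' t)\<^sup>2 + \<omega>\<^sup>2 * (e t)\<^sup>2 + C\<^sup>2 * \<epsilon>\<^sup>2)"
  define \<Psi> where "\<Psi> = (\<lambda>t. N t * exp (- (L * \<epsilon> * t)))"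
  have L: "K + 1 \<le> L" "1 \<le> L" "K \<le> L * \<omega>\<^sup>2"
    using \<open>\<omega> > 0\<close> \<open>K \<ge> 0\<close> by (auto simp: L_def field_simps)
  \<comment> \<open>Smallness of \<open>e\<close> is assumed only strictly before \<open>t\<close>,
    which is exactly what the bootstrap provides. It suffices because monotonicity of
    \<open>\<Psi>\<close> needs its derivative only in the interior of the interval.\<close>
  have N_le: "N t \<le> m" if t: "t \<in> {0..\<tau>}" and small: "\<And>s. s \<in> {0..<t} \<Longrightarrow> \<bar>e s\<bar> < 1" for t
  proof -
    have "\<Psi> t \<le> \<Psi> 0"
    proof (rule DERIV_nonpos_imp_decreasing_open[where f = \<Psi>])
      show "0 \<le> t" using t by simp
      have sub: "{0..t} \<subseteq> {0..\<tau>}" using t by auto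
      show "continuous_on {0..t} \<Psi>"
        unfolding \<Psi>_def N_def by (intro continuous_intros continuous_on_subset[OF cont(1) sub] continuous_on_subset[OF cont(2) sub])
      fix s assume s: "0 < s" "s < t"
      then have s\<tau>: "s < \<tau>" using t by simp
      define N' where "N' = 2 * e' s * (- (\<epsilon> * G s * e s) - R s)"
      have "(N has_real_derivative N') (at s)"
        unfolding N_def by (auto intro!: derivative_eq_intros der s s\<tau> simp: N'_def algebra_simps)
      then have "(\<Psi> has_real_derivative (N' - \<epsilon> * L * N s) * exp (- (L * \<epsilon> * s))) (at s)"
        unfolding \<Psi>_def by (auto intro!: derivative_eq_intros simp: algebra_simps)
      moreover have "N' \<le> \<epsilon> * L * N s"
      proof -
        have "0 \<le> (\<bar>e s\<bar> - \<bar>e' s\<bar>)\<^sup>2" by simp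
        then have am: "2 * (\<bar>e s\<bar> * \<bar>e' s\<bar>) \<le> (e s)\<^sup>2 + (e' s)\<^sup>2"
          by (simp add: power2_diff)
        have "\<bar>G s\<bar> * (\<bar>e s\<bar> * \<bar>e' s\<bar>) \<le> K * (\<bar>e s\<bar> * \<bar>e' s\<bar>)"
          using G[of s] small[of s] s s\<tau> by (intro mult_right_mono) auto
        also have "2 * \<dots> \<le> K * ((e s)\<^sup>2 + (e' s)\<^sup>2)"
          using mult_left_mono[OF am \<open>K \<ge> 0\<close>] by (simp add: algebra_simps)
        finally have "2 * (\<bar>G s\<bar> * (\<bar>e s\<bar> * \<bar>e' s\<bar>)) \<le> K * ((e s)\<^sup>2 + (e' s)\<^sup>2)"
          by simp
        moreover have "- (2 * e' s * G s * e s) \<le> 2 * (\<bar>G s\<bar> * (\<bar>e s\<bar> * \<bar>e' s\<bar>))"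
          using abs_ge_minus_self[of "2 * e' s * G s * e s"] by (simp add: abs_mult ac_simps)
        ultimately have "- (2 * e' s * G s * e s) \<le> K * ((e s)\<^sup>2 + (e' s)\<^sup>2)"
          by linarith
        then have 1: "\<epsilon> * - (2 * e' s * G s * e s) \<le> \<epsilon> * (K * ((e s)\<^sup>2 + (e' s)\<^sup>2))"
          using \<open>\<epsilon> > 0\<close> by (rule mult_left_mono[OF _ less_imp_le])
        \<comment> \<open>The source has size \<open>C * \<epsilon>\<^sup>2\<close>. Splitting off
          one factor \<epsilon> before comparing \<open>e'\<close> with
          \<open>C * \<epsilon>\<close> keeps that factor in front of the energy.\<close>
        have "0 \<le> (\<bar>e' s\<bar> - C * \<epsilon>)\<^sup>2" by simp
        then have am2: "2 * (\<bar>e' s\<bar> * (C * \<epsilon>)) \<le> (e' s)\<^sup>2 + C\<^sup>2 * \<epsilon>\<^sup>2"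
          by (simp add: power2_diff power_mult_distrib)
        have "- (2 * e' s * R s) \<le> 2 * (\<bar>e' s\<bar> * \<bar>R s\<bar>)"
          using abs_ge_minus_self[of "2 * e' s * R s"] by (simp add: abs_mult)
        also have "\<dots> \<le> 2 * (\<bar>e' s\<bar> * (C * \<epsilon>\<^sup>2))"
          using R[of s] s s\<tau> by (intro mult_left_mono) auto
        also have "\<dots> = \<epsilon> * (2 * (\<bar>e' s\<bar> * (C * \<epsilon>)))"
          by (simp add: power2_eq_square)
        also have "\<dots> \<le> \<epsilon> * ((e' s)\<^sup>2 + C\<^sup>2 * \<epsilon>\<^sup>2)"
          using am2 \<open>\<epsilon> > 0\<close> by (intro mult_left_mono) auto
        finally have 2: "- (2 * e' s * R s) \<le> \<epsilon> * ((e' s)\<^sup>2 + C\<^sup>2 * \<epsilon>\<^sup>2)" .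
        have "N' = \<epsilon> * - (2 * e' s * G s * e s) + - (2 * e' s * R s)"
          by (simp add: N'_def algebra_simps)
        also have "\<dots> \<le> \<epsilon> * (K * ((e s)\<^sup>2 + (e' s)\<^sup>2)) + \<epsilon> * ((e' s)\<^sup>2 + C\<^sup>2 * \<epsilon>\<^sup>2)"
          using 1 2 by (rule add_mono)
        also have "\<dots> = \<epsilon> * (K * (e s)\<^sup>2 + (K + 1) * (e' s)\<^sup>2 + 1 * (C\<^sup>2 * \<epsilon>\<^sup>2))"
          by (simp add: algebra_simps)
        also have "\<dots> \<le> \<epsilon> * ((L * \<omega>\<^sup>2) * (e s)\<^sup>2 + L * (e' s)\<^sup>2 + L * (C\<^sup>2 * \<epsilon>\<^sup>2))"
          using L \<open>\<epsilon> > 0\<close> by (intro mult_left_mono add_mono mult_right_mono) auto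
        also have "\<dots> = \<epsilon> * L * N s"
          by (simp add: N_def algebra_simps)
        finally show ?thesis .
      qed
      ultimately show "\<exists>y. (\<Psi> has_real_derivative y) (at s) \<and> y \<le> 0"
        by (intro exI[of _ "(N' - \<epsilon> * L * N s) * exp (- (L * \<epsilon> * s))"] conjI)
           (auto simp: mult_le_0_iff)
    qed
    then have "N t \<le> N 0 * exp (L * \<epsilon> * t)"
      by (simp add: \<Psi>_def exp_minus field_simps)
    also have "\<dots> \<le> N 0 * exp L"
    proof -
      have "\<epsilon> * t \<le> \<epsilon> * \<tau>" using t \<open>\<epsilon> > 0\<close> by simp
      then have "L * (\<epsilon> * t) \<le> L * 1"
        using L \<open>\<epsilon> * \<tau> \<le> 1\<close> by (intro mult_left_mono) auto
      then show ?thesis by (intro mult_left_mono) (auto simp: N_def mult.assoc)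
    qed
    also have "\<dots> \<le> m" using m(1) by (simp add: N_def L_def)
    finally show ?thesis .
  qed
  \<comment> \<open>Here the bootstrap closes:
    \<open>\<omega>\<^sup>2 * e^2 \<le> N \<le> m < \<omega>\<^sup>2\<close>.\<close>
  have "\<bar>e t\<bar> < 1" if "t \<in> {0..\<tau>}" for t
  proof (rule continuous_on_bootstrap[where f = "\<lambda>t. \<bar>e t\<bar>", OF _ _ that])
    show "continuous_on {0..\<tau>} (\<lambda>t. \<bar>e t\<bar>)" by (intro continuous_intros cont)
    fix t assume "t \<in> {0..\<tau>}" "\<And>s. s \<in> {0..<t} \<Longrightarrow> \<bar>e s\<bar> < 1"
    then have "N t < \<omega>\<^sup>2" using N_le m(2) by fastforce
    moreover have "\<omega>\<^sup>2 * (e t)\<^sup>2 \<le> N t" by (simp add: N_def)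
    ultimately have "\<omega>\<^sup>2 * (e t)\<^sup>2 < \<omega>\<^sup>2 * 1" by linarith
    then have "(e t)\<^sup>2 < 1" using \<open>\<omega> > 0\<close> by (simp only: mult_less_cancel_left_pos zero_less_power)
    then show "\<bar>e t\<bar> < 1" by (simp add: abs_square_less_1)
  qed
  then have "N t \<le> m" using t by (intro N_le) auto
  moreover have "0 \<le> C\<^sup>2 * \<epsilon>\<^sup>2" by simp
  ultimately show ?thesis unfolding N_def by linarith
qed

text \<open>Serves twice: \<open>k = 1\<close> enlarges the bound, and
  \<open>k = 1 / \<epsilon>\<close> passes from \<open>\<epsilon> * r\<close> to
  \<open>r\<close>.\<close>

lemma C2_bounded_by_cmult:
  assumes "C2_bounded_by I M f" "\<bar>k\<bar> * M \<le> M'"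
  shows "C2_bounded_by I M' (\<lambda>t. k * f t)"
proof -
  obtain f' f'' where f: "continuous_on I f''"
    "\<And>t. t \<in> I \<Longrightarrow> (f has_real_derivative f' t) (at t) \<and> (f' has_real_derivative f'' t) (at t) \<and>
       \<bar>f t\<bar> \<le> M \<and> \<bar>f' t\<bar> \<le> M \<and> \<bar>f'' t\<bar> \<le> M"
    using assms(1) unfolding C2_bounded_by_def by metis
  have "\<bar>k * x\<bar> \<le> M'" if "\<bar>x\<bar> \<le> M" for x
    using mult_left_mono[OF that abs_ge_zero[of k]] assms(2) by (simp add: abs_mult)
  then show ?thesis
    unfolding C2_bounded_by_def using f
    by (intro exI[of _ "\<lambda>t. k * f' t"] exI[of _ "\<lambda>t. k * f'' t"])
       (auto intro!: continuous_intros DERIV_cmult)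
qed

lemma abs_mult_le_of_abs_le_1: "\<bar>x\<bar> \<le> 1 \<Longrightarrow> \<bar>k * x\<bar> \<le> \<bar>k\<bar>" for k x :: real
  using mult_left_mono[of "\<bar>x\<bar>" 1 "\<bar>k\<bar>"] by (simp add: abs_mult)

section \<open>The approximate solution and its residual\<close>

locale weakly_nonlinear_oscillator =
  fixes \<omega> c d a :: real
  assumes \<omega>: "\<omega> > 0"
begin

text \<open>Since \<open>cos^2 = 1/2 + cos 2\<phi> / 2\<close> and
  \<open>cos^3 = 3/4 cos \<phi> + cos 3\<phi> / 4\<close>, the value
  \<open>2 * \<omega> * \<omega>1 * a = 3/4 * d * a^3\<close> balances the resonant term. The
  amplitudes \<open>p\<close>, \<open>q\<close>, \<open>s\<close> come from dividing the other
  harmonics by the factors \<open>\<omega>^2\<close>, \<open>-3 * \<omega>^2\<close>,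
  \<open>-8 * \<omega>^2\<close> with which \<open>x'' + \<omega>^2 * x\<close> acts on them at
  leading order.\<close>

definition \<omega>1 where "\<omega>1 = 3 * d * a\<^sup>2 / (8 * \<omega>)"
definition p where "p = - (c * a\<^sup>2) / (2 * \<omega>\<^sup>2)"
definition q where "q = c * a\<^sup>2 / (6 * \<omega>\<^sup>2)"
definition s where "s = d * a ^ 3 / (32 * \<omega>\<^sup>2)"

abbreviation freq where "freq \<equiv> \<nu> \<omega> d a"

lemma freq_eq: "freq \<epsilon> = \<omega> + \<epsilon> * \<omega>1"
  by (simp add: \<nu>_def \<omega>1_def)

definition corr where
  "corr \<epsilon> t = p + q * cos (2 * (freq \<epsilon> * t)) + s * cos (3 * (freq \<epsilon> * t))"
definition corr' where
  "corr' \<epsilon> t = - freq \<epsilon> * (2 * q * sin (2 * (freq \<epsilon> * t)) + 3 * s * sin (3 * (freq \<epsilon> * t)))"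
definition corr'' where
  "corr'' \<epsilon> t = - (freq \<epsilon>)\<^sup>2 * (4 * q * cos (2 * (freq \<epsilon> * t)) + 9 * s * cos (3 * (freq \<epsilon> * t)))"

definition appr where "appr \<epsilon> t = a * cos (freq \<epsilon> * t) + \<epsilon> * corr \<epsilon> t"
definition appr' where "appr' \<epsilon> t = - (a * freq \<epsilon> * sin (freq \<epsilon> * t)) + \<epsilon> * corr' \<epsilon> t"
definition appr'' where "appr'' \<epsilon> t = - (a * (freq \<epsilon>)\<^sup>2 * cos (freq \<epsilon> * t)) + \<epsilon> * corr'' \<epsilon> t"

text \<open>The defect of \<open>appr\<close> in the rescaled equation satisfied by
  \<open>u / \<epsilon>\<close>.\<close>

definition residual where
  "residual \<epsilon> t = appr'' \<epsilon> t + \<omega>\<^sup>2 * appr \<epsilon> t + \<epsilon> * (c * (appr \<epsilon> t)\<^sup>2 + d * (appr \<epsilon> t) ^ 3)"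

lemma has_real_derivative_appr: "(appr \<epsilon> has_real_derivative appr' \<epsilon> t) (at t within S)"
  unfolding appr_def[abs_def] appr'_def corr_def corr'_def
  by (auto intro!: derivative_eq_intros simp: algebra_simps)

lemma has_real_derivative_appr': "(appr' \<epsilon> has_real_derivative appr'' \<epsilon> t) (at t within S)"
  unfolding appr'_def[abs_def] appr''_def corr'_def corr''_def
  by (auto intro!: derivative_eq_intros simp: algebra_simps power2_eq_square)

text \<open>Sorting by powers of \<epsilon>, with \<open>C1\<close>, \<open>C2\<close>,
  \<open>C3\<close> in place of the cosines of the single, double and triple phase; as independent
  variables they leave a polynomial identity. The terms of order zero cancel.\<close>

lemma residual_expand:
  fixes C1 C2 C3 :: real
  defines "b \<equiv> p + q * C2 + s * C3"
  shows "(- (a * (\<omega> + \<epsilon> * \<omega>1)\<^sup>2 * C1) + \<epsilon> * (- (\<omega> + \<epsilon> * \<omega>1)\<^sup>2 * (4 * q * C2 + 9 * s * C3)))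
      + \<omega>\<^sup>2 * (a * C1 + \<epsilon> * b) + \<epsilon> * (c * (a * C1 + \<epsilon> * b)\<^sup>2 + d * (a * C1 + \<epsilon> * b) ^ 3)
    = \<epsilon> * (- (2 * \<omega> * \<omega>1) * a * C1 + \<omega>\<^sup>2 * p - 3 * (\<omega>\<^sup>2 * q) * C2 - 8 * (\<omega>\<^sup>2 * s) * C3
           + c * a\<^sup>2 * C1\<^sup>2 + d * a ^ 3 * C1 ^ 3)
    + \<epsilon>\<^sup>2 * (- (\<omega>1\<^sup>2 * a * C1) - (2 * \<omega> * \<omega>1 + \<epsilon> * \<omega>1\<^sup>2) * (4 * q * C2 + 9 * s * C3)
           + c * b * (2 * a * C1 + \<epsilon> * b)
           + d * b * (3 * a\<^sup>2 * C1\<^sup>2 + 3 * a * C1 * (\<epsilon> * b) + \<epsilon>\<^sup>2 * b\<^sup>2))"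
  unfolding b_def by algebra

text \<open>With \<open>X = cos \<phi>\<close> this is the coefficient of \<epsilon> in the
  residual, as \<open>2 * X^2 - 1 = cos 2\<phi>\<close> and
  \<open>4 * X^3 - 3 * X = cos 3\<phi>\<close>. The choice of \<open>\<omega>1\<close>,
  \<open>p\<close>, \<open>q\<close>, \<open>s\<close> makes it vanish identically in
  \<open>X\<close>.\<close>

lemma secular_terms_cancel:
  fixes X :: real
  shows "- (2 * \<omega> * \<omega>1) * a * X + \<omega>\<^sup>2 * p - 3 * (\<omega>\<^sup>2 * q) * (2 * X\<^sup>2 - 1)
    - 8 * (\<omega>\<^sup>2 * s) * (4 * X ^ 3 - 3 * X) + c * a\<^sup>2 * X\<^sup>2 + d * a ^ 3 * X ^ 3 = 0"
proof -
  have rel: "2 * \<omega> * \<omega>1 = 3 / 4 * (d * a\<^sup>2)" "\<omega>\<^sup>2 * p = - (c * a\<^sup>2) / 2"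
    "\<omega>\<^sup>2 * q = c * a\<^sup>2 / 6" "\<omega>\<^sup>2 * s = d * a ^ 3 / 32"
    using \<omega> by (simp_all add: \<omega>1_def p_def q_def s_def)
  show ?thesis
    unfolding rel by (simp add: field_simps power2_eq_square power3_eq_cube)
qed

text \<open>After the cancellation the residual is \<open>\<epsilon>\<^sup>2\<close> times a
  polynomial in \<epsilon> and the cosine of the phase. That pair ranges over a compact rectangle,
  so the constant is uniform in time.\<close>

lemma residual_bound:
  obtains C where "C \<ge> 0" "\<And>\<epsilon> t. 0 < \<epsilon> \<Longrightarrow> \<epsilon> \<le> 1 \<Longrightarrow> \<bar>residual \<epsilon> t\<bar> \<le> C * \<epsilon>\<^sup>2"
proof -
  define b where "b X = p + q * (2 * X\<^sup>2 - 1) + s * (4 * X ^ 3 - 3 * X)" for X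
  define P where "P = (\<lambda>(\<epsilon>, X). - (\<omega>1\<^sup>2 * a * X)
    - (2 * \<omega> * \<omega>1 + \<epsilon> * \<omega>1\<^sup>2) * (4 * q * (2 * X\<^sup>2 - 1) + 9 * s * (4 * X ^ 3 - 3 * X))
    + c * b X * (2 * a * X + \<epsilon> * b X)
    + d * b X * (3 * a\<^sup>2 * X\<^sup>2 + 3 * a * X * (\<epsilon> * b X) + \<epsilon>\<^sup>2 * (b X)\<^sup>2))"
  have res: "residual \<epsilon> t = \<epsilon>\<^sup>2 * P (\<epsilon>, cos (freq \<epsilon> * t))" for \<epsilon> t
    unfolding residual_def appr''_def appr_def corr''_def corr_def freq_eq
      residual_expand cos_double_cos cos_treble_cos secular_terms_cancel
    by (simp add: P_def b_def)
  let ?S = "{0..1::real} \<times> {-1..1::real}"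
  have "continuous_on ?S P"
    unfolding P_def b_def case_prod_beta by (intro continuous_intros)
  then have "compact (P ` ?S)"
    by (intro compact_continuous_image compact_Times) auto
  then obtain C where C: "\<forall>y\<in>P ` ?S. norm y \<le> C"
    using compact_imp_bounded bounded_iff by blast
  show ?thesis
  proof (rule that[of "\<bar>C\<bar>"])
    fix \<epsilon> t :: real assume "0 < \<epsilon>" "\<epsilon> \<le> 1"
    then have "(\<epsilon>, cos (freq \<epsilon> * t)) \<in> ?S" by auto
    then have "\<bar>P (\<epsilon>, cos (freq \<epsilon> * t))\<bar> \<le> \<bar>C\<bar>"
      using bspec[OF C imageI] by fastforce
    then have "\<epsilon>\<^sup>2 * \<bar>P (\<epsilon>, cos (freq \<epsilon> * t))\<bar> \<le> \<epsilon>\<^sup>2 * \<bar>C\<bar>"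
      by (intro mult_left_mono) auto
    then show "\<bar>residual \<epsilon> t\<bar> \<le> \<bar>C\<bar> * \<epsilon>\<^sup>2"
      by (simp add: res abs_mult mult.commute)
  qed auto
qed

lemma abs_freq_le: "0 < \<epsilon> \<Longrightarrow> \<epsilon> \<le> 1 \<Longrightarrow> \<bar>freq \<epsilon>\<bar> \<le> \<omega> + \<bar>\<omega>1\<bar>"
  using abs_mult_le_of_abs_le_1[of \<epsilon> \<omega>1] \<omega> by (simp add: freq_eq mult.commute)

lemma abs_corr_le: "\<bar>corr \<epsilon> t\<bar> \<le> \<bar>p\<bar> + \<bar>q\<bar> + \<bar>s\<bar>"
  using abs_mult_le_of_abs_le_1[OF abs_cos_le_one, of q "2 * (freq \<epsilon> * t)"]
    abs_mult_le_of_abs_le_1[OF abs_cos_le_one, of s "3 * (freq \<epsilon> * t)"]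
  unfolding corr_def by linarith

lemma abs_corr'_le:
  assumes "0 < \<epsilon>" "\<epsilon> \<le> 1"
  shows "\<bar>corr' \<epsilon> t\<bar> \<le> (\<omega> + \<bar>\<omega>1\<bar>) * (2 * \<bar>q\<bar> + 3 * \<bar>s\<bar>)"
proof -
  have "\<bar>2 * q * sin (2 * (freq \<epsilon> * t)) + 3 * s * sin (3 * (freq \<epsilon> * t))\<bar> \<le> 2 * \<bar>q\<bar> + 3 * \<bar>s\<bar>"
    using abs_mult_le_of_abs_le_1[OF abs_sin_le_one, of "2 * q" "2 * (freq \<epsilon> * t)"]
      abs_mult_le_of_abs_le_1[OF abs_sin_le_one, of "3 * s" "3 * (freq \<epsilon> * t)"]
    unfolding abs_mult[of 2 q] abs_mult[of 3 s] by linarith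
  then show ?thesis
    unfolding corr'_def abs_mult[of "- freq \<epsilon>"] abs_minus_cancel
    using abs_freq_le[OF assms] by (intro mult_mono) auto
qed

lemma abs_corr''_le:
  assumes "0 < \<epsilon>" "\<epsilon> \<le> 1"
  shows "\<bar>corr'' \<epsilon> t\<bar> \<le> (\<omega> + \<bar>\<omega>1\<bar>)\<^sup>2 * (4 * \<bar>q\<bar> + 9 * \<bar>s\<bar>)"
proof -
  have "\<bar>4 * q * cos (2 * (freq \<epsilon> * t)) + 9 * s * cos (3 * (freq \<epsilon> * t))\<bar> \<le> 4 * \<bar>q\<bar> + 9 * \<bar>s\<bar>"
    using abs_mult_le_of_abs_le_1[OF abs_cos_le_one, of "4 * q" "2 * (freq \<epsilon> * t)"]
      abs_mult_le_of_abs_le_1[OF abs_cos_le_one, of "9 * s" "3 * (freq \<epsilon> * t)"]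
    unfolding abs_mult[of 4 q] abs_mult[of 9 s] by linarith
  moreover have "\<bar>- (freq \<epsilon>)\<^sup>2\<bar> \<le> (\<omega> + \<bar>\<omega>1\<bar>)\<^sup>2"
    using power_mono[OF abs_freq_le[OF assms] abs_ge_zero, of 2] by simp
  ultimately show ?thesis
    unfolding corr''_def abs_mult[of "- (freq \<epsilon>)\<^sup>2"] by (intro mult_mono) auto
qed

section \<open>Comparison of the exact and the approximate solution\<close>

text \<open>Differences of squares and of cubes contain the factor \<open>w - y\<close>, so the
  nonlinearity enters the equation of the error as a bounded multiplier times \<epsilon> times the
  error; the residual of \<open>y\<close> is the source.\<close>

lemma error_equation:
  fixes w y y'' :: real
  shows "- (\<omega>\<^sup>2 * w + \<epsilon> * (c * w\<^sup>2 + d * w ^ 3)) - y''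
    = - (\<omega>\<^sup>2 * (w - y)) - \<epsilon> * (c * (w + y) + d * (w\<^sup>2 + w * y + y\<^sup>2)) * (w - y)
      - (y'' + \<omega>\<^sup>2 * y + \<epsilon> * (c * y\<^sup>2 + d * y ^ 3))"
  by algebra

lemma cubic_difference_bound:
  fixes w y :: real
  assumes "\<bar>y\<bar> \<le> A" "\<bar>w - y\<bar> \<le> 1"
  shows "\<bar>c * (w + y) + d * (w\<^sup>2 + w * y + y\<^sup>2)\<bar> \<le> \<bar>c\<bar> * (2 * A + 1) + \<bar>d\<bar> * (3 * (A + 1)\<^sup>2)"
proof -
  have w: "\<bar>w\<bar> \<le> A + 1" and y: "\<bar>y\<bar> \<le> A + 1" using assms by auto
  have "\<bar>w * y\<bar> \<le> (A + 1)\<^sup>2" "\<bar>w * w\<bar> \<le> (A + 1)\<^sup>2" "\<bar>y * y\<bar> \<le> (A + 1)\<^sup>2"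
    unfolding abs_mult power2_eq_square by (rule mult_mono[OF w y] mult_mono[OF w w] mult_mono[OF y y]; use w in linarith)+
  moreover have "\<bar>w\<^sup>2 + w * y + y\<^sup>2\<bar> \<le> \<bar>w * w\<bar> + \<bar>w * y\<bar> + \<bar>y * y\<bar>"
    unfolding power2_eq_square by (intro order_trans[OF abs_triangle_ineq] add_mono order_refl)
  ultimately have "\<bar>w\<^sup>2 + w * y + y\<^sup>2\<bar> \<le> 3 * (A + 1)\<^sup>2"
    by simp
  moreover have "\<bar>w + y\<bar> \<le> 2 * A + 1" using assms by linarith
  ultimately have "\<bar>c\<bar> * \<bar>w + y\<bar> + \<bar>d\<bar> * \<bar>w\<^sup>2 + w * y + y\<^sup>2\<bar> \<le> \<bar>c\<bar> * (2 * A + 1) + \<bar>d\<bar> * (3 * (A + 1)\<^sup>2)"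
    by (intro add_mono mult_left_mono) auto
  then show ?thesis
    using abs_triangle_ineq[of "c * (w + y)" "d * (w\<^sup>2 + w * y + y\<^sup>2)"]
    unfolding abs_mult by linarith
qed

text \<open>The parameter \<rho> measures the relative error of the initial data and dominates
  \<epsilon>. All bounds are linear in \<rho>, with \<open>K\<close> depending only on the
  coefficients and the amplitude, so that one statement serves both data of accuracy
  \<open>o(\<epsilon>)\<close> (fixed small \<rho>) and of accuracy \<open>O(\<epsilon>^2)\<close>
  (\<rho> proportional to \<epsilon>).\<close>

lemma maximal_solution_estimate:
  obtains K where "K \<ge> 1"
    "\<And>\<epsilon> \<rho> T u v. 0 < \<epsilon> \<Longrightarrow> \<epsilon> \<le> \<rho> \<Longrightarrow> K * \<rho> \<le> 1 \<Longrightarrow> maximal_solution \<omega> c d \<epsilon> T u v \<Longrightarrow>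
       \<bar>u 0 - \<epsilon> * a\<bar> \<le> \<epsilon> * \<rho> \<Longrightarrow> \<bar>v 0\<bar> \<le> \<epsilon> * \<rho> \<Longrightarrow>
       ereal (1 / \<epsilon>) < T \<and> C2_bounded_by {0<..<1 / \<epsilon>} (K * \<rho>) (\<lambda>t. u t / \<epsilon> - a * cos (freq \<epsilon> * t))"
proof -
  obtain C where C: "C \<ge> 0" "\<And>\<epsilon> t. 0 < \<epsilon> \<Longrightarrow> \<epsilon> \<le> 1 \<Longrightarrow> \<bar>residual \<epsilon> t\<bar> \<le> C * \<epsilon>\<^sup>2"
    by (rule residual_bound) blast
  \<comment> \<open>\<open>F\<close> bounds the frequency, \<open>B0\<close>, \<open>B1\<close>,
    \<open>B2\<close> the correction and its derivatives, \<open>A\<close> the approximation,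
    \<open>G0\<close> the multiplier in the error equation. \<open>Q2 * \<rho>^2\<close> is the
    initial energy plus source, times the growth factor; thus \<open>Q * \<rho>\<close> bounds
    \<open>e'\<close> and \<open>E * \<rho>\<close> bounds \<open>e\<close>. \<open>K\<close>
    collects the bounds for the remainder, its first and its second derivative.\<close>
  define F where "F = \<omega> + \<bar>\<omega>1\<bar>"
  define B0 where "B0 = \<bar>p\<bar> + \<bar>q\<bar> + \<bar>s\<bar>"
  define B1 where "B1 = F * (2 * \<bar>q\<bar> + 3 * \<bar>s\<bar>)"
  define B2 where "B2 = F\<^sup>2 * (4 * \<bar>q\<bar> + 9 * \<bar>s\<bar>)"
  define A where "A = \<bar>a\<bar> + B0"
  define G0 where "G0 = \<bar>c\<bar> * (2 * A + 1) + \<bar>d\<bar> * (3 * (A + 1)\<^sup>2)"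
  define Q2 where "Q2 = (1 + \<omega>\<^sup>2 * (1 + B0)\<^sup>2 + C\<^sup>2) * exp (G0 + G0 / \<omega>\<^sup>2 + 1)"
  define Q where "Q = sqrt Q2"
  define E where "E = Q / \<omega>"
  define K where "K = 1 + E + B0 + Q + B1 + \<omega>\<^sup>2 * E + G0 * E + C + B2"
  have nonneg: "F \<ge> 0" "B0 \<ge> 0" "B1 \<ge> 0" "B2 \<ge> 0" "A \<ge> 0" "G0 \<ge> 0" "Q2 \<ge> 0" "Q \<ge> 0" "E \<ge> 0"
    using \<omega> by (simp_all add: F_def B0_def B1_def B2_def A_def G0_def Q2_def Q_def E_def)
  have nonneg': "\<omega>\<^sup>2 * E \<ge> 0" "G0 * E \<ge> 0"
    using nonneg by simp_all
  have Q: "Q\<^sup>2 = Q2" "Q = \<omega> * E"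
    using nonneg \<omega> by (simp_all add: Q_def E_def)
  show ?thesis
  proof (rule that[of K], goal_cases)
    case 1
    show ?case using nonneg nonneg' C(1) by (simp add: K_def)
  next
    case (2 \<epsilon> \<rho> T u v)
    note \<epsilon> = \<open>0 < \<epsilon>\<close>
    have \<rho>: "\<rho> > 0" using 2 by linarith
    have "1 * \<rho> \<le> K * \<rho>" using nonneg nonneg' C(1) \<rho> by (intro mult_right_mono) (auto simp: K_def)
    then have \<epsilon>1: "\<epsilon> \<le> 1" using 2 by linarith
    \<comment> \<open>The summand 1 in \<open>K\<close> makes this strict, which gives the strict
      inequality \<open>(Q * \<rho>)^2 < \<omega>^2\<close> needed by the energy estimate.\<close>
    have "E < K" using nonneg nonneg' C(1) unfolding K_def by linarith
    then have "E * \<rho> < K * \<rho>" using \<rho> by (rule mult_strict_right_mono)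
    then have E\<rho>: "E * \<rho> < 1" using 2 by linarith
    define I where "I = forward_interval T"
    define e where "e = (\<lambda>t. u t / \<epsilon> - appr \<epsilon> t)"
    define e' where "e' = (\<lambda>t. v t / \<epsilon> - appr' \<epsilon> t)"
    define G where "G = (\<lambda>t. c * (u t / \<epsilon> + appr \<epsilon> t) + d * ((u t / \<epsilon>)\<^sup>2 + u t / \<epsilon> * appr \<epsilon> t + (appr \<epsilon> t)\<^sup>2))"
    \<comment> \<open>The acceleration of the rescaled solution
      \<open>u / \<epsilon>\<close>.\<close>
    define z where "z = (\<lambda>t. - (\<omega>\<^sup>2 * (u t / \<epsilon>) + \<epsilon> * (c * (u t / \<epsilon>)\<^sup>2 + d * (u t / \<epsilon>) ^ 3)))"
    have sol: "(u has_real_derivative v t) (at t within I)"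
      "(v has_real_derivative \<epsilon> * z t) (at t within I)" if "t \<in> I" for t
    proof -
      have "- (\<omega>\<^sup>2 * u t + c * (u t)\<^sup>2 + d / \<epsilon> * (u t) ^ 3) = \<epsilon> * z t"
        using \<epsilon> by (simp add: z_def field_simps power2_eq_square power3_eq_cube)
      then show "(u has_real_derivative v t) (at t within I)"
        "(v has_real_derivative \<epsilon> * z t) (at t within I)"
        using 2(4) that unfolding maximal_solution_def solves_on_iff I_def by auto
    qed
    \<comment> \<open>At positive times before \<open>T\<close> the derivatives of the solution are
      two-sided.\<close>
    have at: "at t within I = at t" if "0 < t" and tT: "ereal t < T" for t
    proof -
      obtain t' where t': "t < t'" "ereal t' < T"
        using ereal_dense2[OF tT] by auto
      have "t \<in> {0<..<t'}" using that t' by simp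
      moreover have "{0<..<t'} \<subseteq> I"
        using t' by (auto simp: I_def forward_interval_def intro: less_trans[of _ "ereal t'"])
      ultimately show ?thesis
        using at_within_open_subset[of t "{0<..<t'}" I] by simp
    qed
    have z_eq: "z t - appr'' \<epsilon> t = - (\<omega>\<^sup>2 * e t) - \<epsilon> * G t * e t - residual \<epsilon> t" for t
      unfolding z_def e_def G_def residual_def by (rule error_equation)
    have appr_le: "\<bar>appr \<epsilon> t\<bar> \<le> A" for t
    proof -
      have "\<bar>\<epsilon> * corr \<epsilon> t\<bar> \<le> 1 * B0"
        unfolding abs_mult B0_def using \<epsilon> \<epsilon>1 abs_corr_le by (intro mult_mono) auto
      then show ?thesis
        using abs_mult_le_of_abs_le_1[OF abs_cos_le_one, of a "freq \<epsilon> * t"]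
        unfolding appr_def A_def by linarith
    qed
    have G_le: "\<bar>G t\<bar> \<le> G0" if "\<bar>e t\<bar> \<le> 1" for t
      unfolding G_def G0_def by (rule cubic_difference_bound[OF appr_le]) (use that in \<open>simp add: e_def\<close>)
    \<comment> \<open>The approximation starts at \<open>a + \<epsilon> * corr \<epsilon> 0\<close>
      rather than at \<open>a\<close>; this offset is at most \<open>B0 * \<rho>\<close> because
      \<open>\<epsilon> \<le> \<rho>\<close>.\<close>
    have e0: "\<bar>e 0\<bar> \<le> (1 + B0) * \<rho>"
    proof -
      have "e 0 = (u 0 - \<epsilon> * a) / \<epsilon> - \<epsilon> * corr \<epsilon> 0"
        using \<epsilon> by (simp add: e_def appr_def field_simps)
      moreover have "\<bar>(u 0 - \<epsilon> * a) / \<epsilon>\<bar> \<le> \<rho>"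
        using 2 by (simp add: abs_divide pos_divide_le_eq mult.commute)
      moreover have "\<bar>\<epsilon> * corr \<epsilon> 0\<bar> \<le> \<rho> * B0"
        unfolding abs_mult B0_def using 2 \<rho> abs_corr_le by (intro mult_mono) auto
      moreover have "(1 + B0) * \<rho> = \<rho> + \<rho> * B0" by (simp add: algebra_simps)
      ultimately show ?thesis by linarith
    qed
    \<comment> \<open>The approximation contains only cosines, so its velocity vanishes at
      0.\<close>
    have e'0: "\<bar>e' 0\<bar> \<le> \<rho>"
      using 2 by (simp add: e'_def appr'_def corr'_def abs_divide pos_divide_le_eq mult.commute)
    have init: "((e' 0)\<^sup>2 + \<omega>\<^sup>2 * (e 0)\<^sup>2 + C\<^sup>2 * \<epsilon>\<^sup>2) * exp (G0 + G0 / \<omega>\<^sup>2 + 1) \<le> (Q * \<rho>)\<^sup>2"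
    proof -
      have "(e' 0)\<^sup>2 \<le> \<rho>\<^sup>2" "(e 0)\<^sup>2 \<le> ((1 + B0) * \<rho>)\<^sup>2" "\<epsilon>\<^sup>2 \<le> \<rho>\<^sup>2"
        using e0 e'0 \<rho> nonneg 2 by (auto simp flip: abs_le_square_iff)
      then have "(e' 0)\<^sup>2 + \<omega>\<^sup>2 * (e 0)\<^sup>2 + C\<^sup>2 * \<epsilon>\<^sup>2 \<le> \<rho>\<^sup>2 + \<omega>\<^sup>2 * ((1 + B0) * \<rho>)\<^sup>2 + C\<^sup>2 * \<rho>\<^sup>2"
        by (intro add_mono mult_left_mono) auto
      also have "\<dots> = (1 + \<omega>\<^sup>2 * (1 + B0)\<^sup>2 + C\<^sup>2) * \<rho>\<^sup>2"
        by (simp only: power_mult_distrib) (simp add: distrib_right)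
      finally have "((e' 0)\<^sup>2 + \<omega>\<^sup>2 * (e 0)\<^sup>2 + C\<^sup>2 * \<epsilon>\<^sup>2) * exp (G0 + G0 / \<omega>\<^sup>2 + 1)
          \<le> (1 + \<omega>\<^sup>2 * (1 + B0)\<^sup>2 + C\<^sup>2) * \<rho>\<^sup>2 * exp (G0 + G0 / \<omega>\<^sup>2 + 1)"
        by (rule mult_right_mono) simp
      also have "\<dots> = (Q * \<rho>)\<^sup>2"
        unfolding power_mult_distrib Q(1) Q2_def by (simp only: ac_simps)
      finally show ?thesis .
    qed
    have Q\<rho>: "(Q * \<rho>)\<^sup>2 < \<omega>\<^sup>2"
    proof -
      have "\<omega> * (E * \<rho>) < \<omega> * 1" using E\<rho> \<omega> by (intro mult_strict_left_mono)
      then show ?thesis using \<omega> nonneg \<rho> unfolding Q(2) by (intro power_strict_mono) (auto simp: mult.assoc)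
    qed
    \<comment> \<open>The energy estimate is applied on \<open>{0..t}\<close> for each
      \<open>t\<close> inside the lifespan, since it is not yet known that the lifespan exceeds
      \<open>1 / \<epsilon>\<close>.\<close>
    have energy: "(e' t)\<^sup>2 + \<omega>\<^sup>2 * (e t)\<^sup>2 \<le> (Q * \<rho>)\<^sup>2" if t: "0 \<le> t" "t \<le> 1 / \<epsilon>" "ereal t < T" for t
    proof (rule perturbed_oscillator_energy_le[OF \<omega> \<epsilon> \<open>G0 \<ge> 0\<close>, where \<tau> = t and e = e and e' = e'
          and R = "residual \<epsilon>" and G = G and C = C])
      show "\<epsilon> * t \<le> 1" using t(2) \<epsilon> by (simp add: field_simps)
      have sub: "{0..t} \<subseteq> I"
        using t by (auto simp: I_def forward_interval_def intro: le_less_trans[of _ "ereal t"])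
      have "continuous_on I u" "continuous_on I v"
        using sol by (meson DERIV_continuous_on)+
      then show "continuous_on {0..t} e" "continuous_on {0..t} e'"
        unfolding e_def e'_def using \<epsilon> sub
        by (auto intro!: continuous_intros DERIV_continuous_on[OF has_real_derivative_appr]
              DERIV_continuous_on[OF has_real_derivative_appr'] elim: continuous_on_subset)
      fix r assume r: "0 < r" "r < t"
      then have rT: "ereal r < T" using t(3) by (intro less_trans[of "ereal r" "ereal t" T]) simp_all
      then have rI: "r \<in> I" using r by (simp add: I_def forward_interval_def)
      note sol_r = sol[OF rI, unfolded at[OF r(1) rT]]
      show "(e has_real_derivative e' r) (at r)"
        unfolding e_def e'_def
        by (intro DERIV_diff DERIV_cdivide sol_r has_real_derivative_appr)
      have "(e' has_real_derivative \<epsilon> * z r / \<epsilon> - appr'' \<epsilon> r) (at r)"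
        unfolding e'_def by (intro DERIV_diff DERIV_cdivide sol_r has_real_derivative_appr')
      then show "(e' has_real_derivative - (\<omega>\<^sup>2 * e r) - \<epsilon> * G r * e r - residual \<epsilon> r) (at r)"
        using \<epsilon> by (simp add: z_eq)
    qed (use init Q\<rho> G_le C(2)[OF \<epsilon> \<epsilon>1] t in auto)
    have e_le: "\<bar>e t\<bar> \<le> E * \<rho>" and e'_le: "\<bar>e' t\<bar> \<le> Q * \<rho>" if t: "0 \<le> t" "t \<le> 1 / \<epsilon>" "ereal t < T" for t
    proof -
      have "0 \<le> (e' t)\<^sup>2" "0 \<le> \<omega>\<^sup>2 * (e t)\<^sup>2" by simp_all
      then have "(e' t)\<^sup>2 \<le> (Q * \<rho>)\<^sup>2" "(\<omega> * e t)\<^sup>2 \<le> (Q * \<rho>)\<^sup>2"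
        using energy[OF t] unfolding power_mult_distrib[of \<omega>] by linarith+
      then have "\<bar>e' t\<bar> \<le> Q * \<rho>" "\<bar>\<omega> * e t\<bar> \<le> Q * \<rho>"
        using nonneg \<rho> by (simp_all flip: abs_le_square_iff)
      then show "\<bar>e' t\<bar> \<le> Q * \<rho>" "\<bar>e t\<bar> \<le> E * \<rho>"
        using \<omega> by (simp_all add: Q(2) abs_mult mult.assoc)
    qed
    \<comment> \<open>Otherwise the error bounds hold during the whole life of the solution, which
      would then be bounded with finite lifespan.\<close>
    have life: "ereal (1 / \<epsilon>) < T"
    proof (rule ccontr)
      assume "\<not> ereal (1 / \<epsilon>) < T"
      then have T: "T \<le> ereal (1 / \<epsilon>)" by simp
      have appr'_le: "\<bar>appr' \<epsilon> t\<bar> \<le> \<bar>a\<bar> * F + B1" for t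
      proof -
        have "\<bar>a * freq \<epsilon> * sin (freq \<epsilon> * t)\<bar> \<le> \<bar>a\<bar> * F * 1"
          unfolding abs_mult F_def using abs_freq_le[OF \<epsilon> \<epsilon>1] by (intro mult_mono) auto
        moreover have "\<bar>\<epsilon> * corr' \<epsilon> t\<bar> \<le> 1 * B1"
          unfolding abs_mult B1_def F_def using \<epsilon> \<epsilon>1 abs_corr'_le by (intro mult_mono) auto
        ultimately show ?thesis unfolding appr'_def by linarith
      qed
      have lt: "0 \<le> t" "t \<le> 1 / \<epsilon>" "ereal t < T" if "t \<in> forward_interval T" for t
      proof -
        show "0 \<le> t" "ereal t < T" using that by (simp_all add: forward_interval_def)
        then have "ereal t \<le> ereal (1 / \<epsilon>)" using T by order
        then show "t \<le> 1 / \<epsilon>" by simp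
      qed
      define B where "B = A + E * \<rho> + (\<bar>a\<bar> * F + B1) + Q * \<rho>"
      have *: "0 \<le> E * \<rho>" "0 \<le> Q * \<rho>" "0 \<le> \<bar>a\<bar> * F"
        using nonneg \<rho> by simp_all
      show False
      proof (rule maximal_solution_unbounded[OF 2(4), of "\<epsilon> * B"])
        show "T < \<infinity>" using T by (rule le_less_trans) simp
        fix t assume "t \<in> forward_interval T"
        note t = lt[OF this]
        have "\<bar>u t / \<epsilon>\<bar> \<le> B"
          using e_le[OF t] appr_le[of t] * nonneg unfolding B_def e_def by linarith
        then show "\<bar>u t\<bar> \<le> \<epsilon> * B" using \<epsilon> by (simp add: abs_divide pos_divide_le_eq mult.commute)
        have "\<bar>v t / \<epsilon>\<bar> \<le> B"
          using e'_le[OF t] appr'_le[of t] * nonneg unfolding B_def e'_def by linarith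
        then show "\<bar>v t\<bar> \<le> \<epsilon> * B" using \<epsilon> by (simp add: abs_divide pos_divide_le_eq mult.commute)
      qed
    qed
    \<comment> \<open>The remainder is measured against the leading cosine alone, hence equals
      \<open>e + \<epsilon> * corr\<close>: the correction counts as part of it.\<close>
    define y' where "y' = (\<lambda>t. v t / \<epsilon> + a * freq \<epsilon> * sin (freq \<epsilon> * t))"
    define y'' where "y'' = (\<lambda>t. z t + a * (freq \<epsilon>)\<^sup>2 * cos (freq \<epsilon> * t))"
    have "C2_bounded_by {0<..<1 / \<epsilon>} (K * \<rho>) (\<lambda>t. u t / \<epsilon> - a * cos (freq \<epsilon> * t))"
      unfolding C2_bounded_by_def
    proof (rule exI[of _ y'], rule exI[of _ y''], intro conjI ballI)
      have lt: "0 < t" "0 \<le> t" "t \<le> 1 / \<epsilon>" "ereal t < T" "t \<in> I" if "t \<in> {0<..<1 / \<epsilon>}" for t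
      proof -
        show "0 < t" "0 \<le> t" "t \<le> 1 / \<epsilon>" using that by simp_all
        have "ereal t < ereal (1 / \<epsilon>)" using that by simp
        then show "ereal t < T" using life by order
        then show "t \<in> I" using that by (simp add: I_def forward_interval_def)
      qed
      have "continuous_on I u" using sol by (meson DERIV_continuous_on)
      then have "continuous_on {0<..<1 / \<epsilon>} u" by (rule continuous_on_subset) (use lt in auto)
      then show "continuous_on {0<..<1 / \<epsilon>} y''"
        unfolding y''_def z_def using \<epsilon> by (intro continuous_intros) auto
      fix t assume "t \<in> {0<..<1 / \<epsilon>}"
      note t = lt[OF this]
      note sol_t = sol[OF t(5), unfolded at[OF t(1,4)]]
      note e_t = e_le[OF t(2-4)]
      show "((\<lambda>t. u t / \<epsilon> - a * cos (freq \<epsilon> * t)) has_real_derivative y' t) (at t)"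
        unfolding y'_def using \<epsilon> by (auto intro!: derivative_eq_intros sol_t)
      show "(y' has_real_derivative y'' t) (at t)"
        unfolding y'_def y''_def using \<epsilon>
        by (auto intro!: derivative_eq_intros sol_t simp: power2_eq_square)
      have \<epsilon>_mult: "\<bar>\<epsilon> * x\<bar> \<le> X * \<rho>" if "\<bar>x\<bar> \<le> X" for x X
        unfolding abs_mult using mult_mono[of "\<bar>\<epsilon>\<bar>" \<rho> "\<bar>x\<bar>" X] 2 \<rho> that by (simp add: mult.commute)
      have le_K: "X * \<rho> \<le> K * \<rho>" if "X \<le> K" for X using that \<rho> by simp
      have "u t / \<epsilon> - a * cos (freq \<epsilon> * t) = e t + \<epsilon> * corr \<epsilon> t"
        by (simp add: e_def appr_def)
      also have "\<bar>\<dots>\<bar> \<le> (E + B0) * \<rho>"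
        using e_t \<epsilon>_mult[OF abs_corr_le[of \<epsilon> t]] unfolding distrib_right B0_def[symmetric] by linarith
      also have "\<dots> \<le> K * \<rho>"
        using nonneg nonneg' C(1) by (intro le_K) (simp add: K_def)
      finally show "\<bar>u t / \<epsilon> - a * cos (freq \<epsilon> * t)\<bar> \<le> K * \<rho>" .
      have "y' t = e' t + \<epsilon> * corr' \<epsilon> t"
        by (simp add: y'_def e'_def appr'_def)
      also have "\<bar>\<dots>\<bar> \<le> (Q + B1) * \<rho>"
        using e'_le[OF t(2-4)] \<epsilon>_mult[OF abs_corr'_le[OF \<epsilon> \<epsilon>1, of t]]
        unfolding distrib_right[of Q] B1_def F_def by linarith
      also have "\<dots> \<le> K * \<rho>"
        using nonneg nonneg' C(1) by (intro le_K) (simp add: K_def)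
      finally show "\<bar>y' t\<bar> \<le> K * \<rho>" .
      \<comment> \<open>The energy does not control the second derivative of the error; it is read
        off from the error equation.\<close>
      have "y'' t = z t - appr'' \<epsilon> t + \<epsilon> * corr'' \<epsilon> t"
        by (simp add: y''_def appr''_def)
      also have "\<dots> = - (\<omega>\<^sup>2 * e t) - \<epsilon> * (G t * e t) - residual \<epsilon> t + \<epsilon> * corr'' \<epsilon> t"
        by (simp add: z_eq mult.assoc)
      also have "\<bar>\<dots>\<bar> \<le> (\<omega>\<^sup>2 * E + G0 * E + C + B2) * \<rho>"
      proof -
        have "\<bar>\<omega>\<^sup>2 * e t\<bar> \<le> \<omega>\<^sup>2 * (E * \<rho>)"
          unfolding abs_mult using e_t by (simp add: mult_left_mono)
        moreover have "\<bar>\<epsilon> * (G t * e t)\<bar> \<le> 1 * (G0 * (E * \<rho>))"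
          unfolding abs_mult using G_le[of t] e_t E\<rho> \<epsilon> \<epsilon>1 nonneg by (intro mult_mono) auto
        moreover have "\<bar>residual \<epsilon> t\<bar> \<le> C * \<rho>"
        proof -
          have "C * \<epsilon>\<^sup>2 \<le> C * (1 * \<rho>)"
            unfolding power2_eq_square using C(1) \<epsilon> \<epsilon>1 2 by (intro mult_left_mono mult_mono) auto
          then show ?thesis using C(2)[OF \<epsilon> \<epsilon>1, of t] by linarith
        qed
        moreover have "\<bar>\<epsilon> * corr'' \<epsilon> t\<bar> \<le> B2 * \<rho>"
          using \<epsilon>_mult[OF abs_corr''_le[OF \<epsilon> \<epsilon>1, of t]] by (simp add: B2_def F_def)
        ultimately show ?thesis
          unfolding distrib_right mult.assoc by linarith
      qed
      also have "\<dots> \<le> K * \<rho>"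
        using nonneg by (intro le_K) (simp add: K_def)
      finally show "\<bar>y'' t\<bar> \<le> K * \<rho>" .
    qed
    with life show ?case by blast
  qed
qed

end

section \<open>The expansion as \<epsilon> tends to 0\<close>

text \<open>Errors in the data persist in time: for \<open>c = d = 0\<close> and zero initial
  velocity the remainder is \<open>(u(0) - \<epsilon> * a\<^sub>0) * cos (\<omega> * t)\<close>.
  Data known up to \<open>o(\<epsilon>)\<close> therefore give \<open>\<epsilon> * r\<close> tending
  to 0 in \<open>C^2\<close>, whereas a uniform bound on \<open>r\<close> itself is obtained for
  data accurate to \<open>O(\<epsilon>^2)\<close>. That the solution lives beyond
  \<open>\<gamma> / \<epsilon>\<close> is part of the conclusion.\<close>

theorem proposition2p1:
  fixes \<omega> c d a\<^sub>0 :: real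
    and u v :: "real \<Rightarrow> real \<Rightarrow> real"
    and T :: "real \<Rightarrow> ereal"
  assumes "\<omega> > 0"
    and "\<forall>\<^sub>F \<epsilon> in at_right 0. maximal_solution \<omega> c d \<epsilon> (T \<epsilon>) (u \<epsilon>) (v \<epsilon>)"
    and "(\<lambda>\<epsilon>. u \<epsilon> 0 - \<epsilon> * a\<^sub>0) \<in> o[at_right 0](\<lambda>\<epsilon>. \<epsilon>)"
    and "(\<lambda>\<epsilon>. v \<epsilon> 0) \<in> o[at_right 0](\<lambda>\<epsilon>. \<epsilon>)"
  shows "\<exists>\<gamma>>0. \<exists>r :: real \<Rightarrow> real \<Rightarrow> real.
     (\<forall>\<^sub>F \<epsilon> in at_right 0. ereal (\<gamma> / \<epsilon>) < T \<epsilon> \<and>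
        (\<forall>t\<in>{0..\<gamma> / \<epsilon>}. u \<epsilon> t = \<epsilon> * a\<^sub>0 * cos (\<nu> \<omega> d a\<^sub>0 \<epsilon> * t) + \<epsilon>\<^sup>2 * r \<epsilon> t)) \<and>
     (\<forall>\<eta>>0. \<forall>\<^sub>F \<epsilon> in at_right 0. C2_bounded_by {0<..<\<gamma> / \<epsilon>} \<eta> (\<lambda>t. \<epsilon> * r \<epsilon> t)) \<and>
     ((\<lambda>\<epsilon>. u \<epsilon> 0 - \<epsilon> * a\<^sub>0) \<in> O[at_right 0](\<lambda>\<epsilon>. \<epsilon>\<^sup>2) \<and> (\<lambda>\<epsilon>. v \<epsilon> 0) \<in> O[at_right 0](\<lambda>\<epsilon>. \<epsilon>\<^sup>2) \<longrightarrow>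
        (\<exists>M. \<forall>\<^sub>F \<epsilon> in at_right 0. C2_bounded_by {0<..<\<gamma> / \<epsilon>} M (r \<epsilon>)))"
proof -
  interpret weakly_nonlinear_oscillator \<omega> c d a\<^sub>0
    by unfold_locales (rule assms(1))
  obtain K where K: "K \<ge> 1"
    "\<And>\<epsilon> \<rho> T u v. 0 < \<epsilon> \<Longrightarrow> \<epsilon> \<le> \<rho> \<Longrightarrow> K * \<rho> \<le> 1 \<Longrightarrow> maximal_solution \<omega> c d \<epsilon> T u v \<Longrightarrow>
       \<bar>u 0 - \<epsilon> * a\<^sub>0\<bar> \<le> \<epsilon> * \<rho> \<Longrightarrow> \<bar>v 0\<bar> \<le> \<epsilon> * \<rho> \<Longrightarrow>
       ereal (1 / \<epsilon>) < T \<and> C2_bounded_by {0<..<1 / \<epsilon>} (K * \<rho>) (\<lambda>t. u t / \<epsilon> - a\<^sub>0 * cos (freq \<epsilon> * t))"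
    by (rule maximal_solution_estimate) blast
  \<comment> \<open>Solving the expansion for \<open>r\<close> makes it hold by definition for
    \<open>\<epsilon> > 0\<close>; only the bounds need proof.\<close>
  define r where "r = (\<lambda>\<epsilon> t. (u \<epsilon> t - \<epsilon> * a\<^sub>0 * cos (freq \<epsilon> * t)) / \<epsilon>\<^sup>2)"
  have pos: "\<forall>\<^sub>F \<epsilon> in at_right (0::real). 0 < \<epsilon>"
    by (simp add: eventually_at_right_less)
  have small: "\<forall>\<^sub>F \<epsilon> in at_right (0::real). \<epsilon> < x" if "x > 0" for x
    using eventually_at_right_real[OF that] by eventually_elim simp
  \<comment> \<open>\<rho> may depend on \<epsilon>, which the case of
    \<open>O(\<epsilon>^2)\<close> data exploits.\<close>
  have estimate: "\<forall>\<^sub>F \<epsilon> in at_right 0. ereal (1 / \<epsilon>) < T \<epsilon> \<and>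
      C2_bounded_by {0<..<1 / \<epsilon>} (K * \<rho> \<epsilon>) (\<lambda>t. \<epsilon> * r \<epsilon> t)"
    if "\<forall>\<^sub>F \<epsilon> in at_right 0. \<epsilon> \<le> \<rho> \<epsilon> \<and> K * \<rho> \<epsilon> \<le> 1"
      "\<forall>\<^sub>F \<epsilon> in at_right 0. \<bar>u \<epsilon> 0 - \<epsilon> * a\<^sub>0\<bar> \<le> \<epsilon> * \<rho> \<epsilon>"
      "\<forall>\<^sub>F \<epsilon> in at_right 0. \<bar>v \<epsilon> 0\<bar> \<le> \<epsilon> * \<rho> \<epsilon>" for \<rho>
    using pos assms(2) that
  proof eventually_elim
    case (elim \<epsilon>)
    have "u \<epsilon> t / \<epsilon> - a\<^sub>0 * cos (freq \<epsilon> * t) = \<epsilon> * r \<epsilon> t" for t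
      using elim(1) by (simp add: r_def field_simps power2_eq_square)
    then show ?case
      using K(2)[of \<epsilon> "\<rho> \<epsilon>" "T \<epsilon>" "u \<epsilon>" "v \<epsilon>"] elim by simp
  qed
  have small_data: "\<forall>\<^sub>F \<epsilon> in at_right 0. ereal (1 / \<epsilon>) < T \<epsilon> \<and>
      C2_bounded_by {0<..<1 / \<epsilon>} (K * \<rho>) (\<lambda>t. \<epsilon> * r \<epsilon> t)" if \<rho>: "0 < \<rho>" "K * \<rho> \<le> 1" for \<rho>
  proof (rule estimate[where \<rho> = "\<lambda>_. \<rho>"])
    show "\<forall>\<^sub>F \<epsilon> in at_right 0. \<epsilon> \<le> \<rho> \<and> K * \<rho> \<le> 1"
      using small[OF \<rho>(1)] by eventually_elim (use \<rho> in simp)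
    show "\<forall>\<^sub>F \<epsilon> in at_right 0. \<bar>u \<epsilon> 0 - \<epsilon> * a\<^sub>0\<bar> \<le> \<epsilon> * \<rho>"
      using pos landau_o.smallD[OF assms(3) \<rho>(1)] by eventually_elim (simp add: mult.commute)
    show "\<forall>\<^sub>F \<epsilon> in at_right 0. \<bar>v \<epsilon> 0\<bar> \<le> \<epsilon> * \<rho>"
      using pos landau_o.smallD[OF assms(4) \<rho>(1)] by eventually_elim (simp add: mult.commute)
  qed
  show ?thesis
  \<comment> \<open>The witness \<open>\<gamma> = 1\<close> matches the time span
    \<open>1 / \<epsilon>\<close> of the energy estimate.\<close>
  proof (rule exI[of _ 1], intro conjI zero_less_one, rule exI[of _ r], intro conjI allI impI)
    have "K * (1 / K) \<le> 1" "1 / K > 0" using K(1) by auto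
    then have "\<forall>\<^sub>F \<epsilon> in at_right 0. ereal (1 / \<epsilon>) < T \<epsilon>"
      using small_data[of "1 / K"] by (auto elim: eventually_mono)
    then show "\<forall>\<^sub>F \<epsilon> in at_right 0. ereal (1 / \<epsilon>) < T \<epsilon> \<and>
        (\<forall>t\<in>{0..1 / \<epsilon>}. u \<epsilon> t = \<epsilon> * a\<^sub>0 * cos (freq \<epsilon> * t) + \<epsilon>\<^sup>2 * r \<epsilon> t)"
      using pos by eventually_elim (simp add: r_def)
  next
    fix \<eta> :: real assume \<eta>: "\<eta> > 0"
    \<comment> \<open>The minimum with 1 secures \<open>K * \<rho> \<le> 1\<close> also for large
      \<eta>.\<close>
    define \<rho> where "\<rho> = min \<eta> 1 / K"
    have \<rho>: "\<rho> > 0" "K * \<rho> \<le> 1" "K * \<rho> \<le> \<eta>" using \<eta> K(1) by (auto simp: \<rho>_def)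
    from small_data[OF \<rho>(1,2)]
    show "\<forall>\<^sub>F \<epsilon> in at_right 0. C2_bounded_by {0<..<1 / \<epsilon>} \<eta> (\<lambda>t. \<epsilon> * r \<epsilon> t)"
      by eventually_elim (use C2_bounded_by_cmult[where k = 1] \<rho>(3) in fastforce)
  next
    assume O: "(\<lambda>\<epsilon>. u \<epsilon> 0 - \<epsilon> * a\<^sub>0) \<in> O[at_right 0](\<lambda>\<epsilon>. \<epsilon>\<^sup>2) \<and>
      (\<lambda>\<epsilon>. v \<epsilon> 0) \<in> O[at_right 0](\<lambda>\<epsilon>. \<epsilon>\<^sup>2)"
    obtain c1 where c1: "c1 > 0" "\<forall>\<^sub>F \<epsilon> in at_right 0. norm (u \<epsilon> 0 - \<epsilon> * a\<^sub>0) \<le> c1 * norm (\<epsilon>\<^sup>2)"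
      using O by (auto elim: landau_o.bigE)
    obtain c2 where c2: "c2 > 0" "\<forall>\<^sub>F \<epsilon> in at_right 0. norm (v \<epsilon> 0) \<le> c2 * norm (\<epsilon>\<^sup>2)"
      using O by (auto elim: landau_o.bigE)
    \<comment> \<open>With \<open>\<rho> = M * \<epsilon>\<close>, the summand 1 ensures
      \<open>\<epsilon> \<le> \<rho>\<close>, and \<open>c1\<close>, \<open>c2\<close> cover the two
      data errors.\<close>
    define M where "M = c1 + c2 + 1"
    have M: "M > 0" "1 \<le> M" "c1 \<le> M" "c2 \<le> M" using c1(1) c2(1) by (auto simp: M_def)
    have le_M: "x * \<epsilon>\<^sup>2 \<le> \<epsilon> * (M * \<epsilon>)" if "x \<le> M" for x \<epsilon> :: real
      using mult_right_mono[OF that, of "\<epsilon>\<^sup>2"] by (simp add: power2_eq_square ac_simps)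
    have "\<forall>\<^sub>F \<epsilon> in at_right 0. ereal (1 / \<epsilon>) < T \<epsilon> \<and>
      C2_bounded_by {0<..<1 / \<epsilon>} (K * (M * \<epsilon>)) (\<lambda>t. \<epsilon> * r \<epsilon> t)"
    proof (rule estimate[where \<rho> = "\<lambda>\<epsilon>. M * \<epsilon>"])
      have "1 / (K * M) > 0" using K(1) M by simp
      from pos small[OF this]
      show "\<forall>\<^sub>F \<epsilon> in at_right 0. \<epsilon> \<le> M * \<epsilon> \<and> K * (M * \<epsilon>) \<le> 1"
        by eventually_elim (use K(1) M in \<open>simp add: field_simps\<close>)
      show "\<forall>\<^sub>F \<epsilon> in at_right 0. \<bar>u \<epsilon> 0 - \<epsilon> * a\<^sub>0\<bar> \<le> \<epsilon> * (M * \<epsilon>)"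
        using c1(2) by eventually_elim (use le_M[OF M(3)] order_trans in force)
      show "\<forall>\<^sub>F \<epsilon> in at_right 0. \<bar>v \<epsilon> 0\<bar> \<le> \<epsilon> * (M * \<epsilon>)"
        using c2(2) by eventually_elim (use le_M[OF M(4)] order_trans in force)
    qed
    with pos have "\<forall>\<^sub>F \<epsilon> in at_right 0. C2_bounded_by {0<..<1 / \<epsilon>} (K * M) (r \<epsilon>)"
    proof eventually_elim
      case (elim \<epsilon>)
      \<comment> \<open>The bound \<open>K * M * \<epsilon>\<close> on \<open>\<epsilon> * r\<close>
        is linear in \<epsilon>, so division by \<epsilon> leaves a constant.\<close>
      have "C2_bounded_by {0<..<1 / \<epsilon>} (K * M) (\<lambda>t. 1 / \<epsilon> * (\<epsilon> * r \<epsilon> t))"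
        by (rule C2_bounded_by_cmult[OF conjunct2[OF elim(2)]]) (use elim(1) in simp)
      then show ?case using elim(1) by simp
    qed
    then show "\<exists>M. \<forall>\<^sub>F \<epsilon> in at_right 0. C2_bounded_by {0<..<1 / \<epsilon>} M (r \<epsilon>)" by blast
  qed
qed

end
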